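(* Let $d\ge2$, $\theta,\theta'\in\Theta_{\mathbb{L}^d}$. (i) (Kullback–Leibler divergence) $$D_{\mathrm{KL}}[p_\theta:p_{\theta'}]=\log\left(\frac{K_{(d-1)/2}(|\theta'|)}{K_{(d-1)/2}(|\theta|)}\right)+\frac{d-1}{2}\left(\log\left(\frac{|\theta|}{|\theta'|}\right)+\frac{[\theta,\theta']}{[\theta,\theta]}-1\right)+\frac{[\theta,\theta-\theta']\,K'_{(d-1)/2}(|\theta|)}{|\theta|\,K_{(d-1)/2}(|\theta|)}.$$ (ii) (Squared Hellinger divergence) For $f(u)=(\sqrt u-1)^2/2$, $$D_f[p_\theta:p_{\theta'}]=1-2^{(d-1)/2}\frac{|\theta|^{(d-1)/4}|\theta'|^{(d-1)/4}K_{(d-1)/2}(|\theta+\theta'|/2)}{|\theta+\theta'|^{(d-1)/2}\sqrt{K_{(d-1)/2}(|\theta|)K_{(d-1)/2}(|\theta'|)}}.$$ (iii) (Neyman chi-squared divergence) For $f(u)=(u-1)^2$, $$D_f[p_\theta:p_{\theta'}]=\begin{cases}\dfrac{|\theta'|^{d-1}K_{(d-1)/2}(|2\theta'-\theta|)K_{(d-1)/2}(|\theta|)}{|2\theta'-\theta|^{(d-1)/2}|\theta|^{(d-1)/2}K_{(d-1)/2}(|\theta'|)^2}-1&\text{if }2\theta'-\theta\in\Theta_{\mathbb{L}^d},\\+\infty&\text{otherwise.}\end{cases}$$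
   Context: The Minkowski inner product on $\mathbb{R}^{d+1}$ is $[x,y]=x_0y_0-x_1y_1-\cdots-x_dy_d$. $\Theta_{\mathbb{L}^d}=\{\theta\in\mathbb{R}^{d+1}:\theta_0>\sqrt{\theta_1^2+\cdots+\theta_d^2}\}$, and $|\theta|=[\theta,\theta]^{1/2}$ for $\theta\in\Theta_{\mathbb{L}^d}$. For $x\in\mathbb{R}^d$ let $\widetilde x=\left(\sqrt{1+\sum_i x_i^2},x_1,\dots,x_d\right)$. The hyperboloid distribution with parameter $\theta\in\Theta_{\mathbb{L}^d}$ is the probability distribution on $\mathbb{R}^d$ with Lebesgue density $$p_\theta(x)=c_d(|\theta|)\,\frac{\exp(-[\theta,\widetilde x])}{\sqrt{1+\sum_i x_i^2}},\qquad c_d(t)=\frac{t^{(d-1)/2}}{2(2\pi)^{(d-1)/2}K_{(d-1)/2}(t)},\ t>0,$$ where $K_\nu$ is the modified Bessel function of the second kind and $K'_\nu$ its derivative. $D_f[p:q]=\int_{\mathbb{R}^d}p\,f(q/p)\,dx$ and $D_{\mathrm{KL}}[p:q]=\int_{\mathbb{R}^d}p\log(p/q)\,dx$. *)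

theory Defs
  imports "HOL-Probability.Probability" "HOL-Real_Asymp.Real_Asymp"
begin

text \<open>The type \<open>real \<times> (real ^ 'n)\<close> is the space of the
  vectors \<open>(x\<^sub>0, (x\<^sub>1, \<dots>, x\<^sub>d))\<close>, with \<open>d = CARD('n)\<close>.\<close>

definition minkowski :: "real \<times> (real ^ 'n) \<Rightarrow> real \<times> (real ^ 'n) \<Rightarrow> real" where
  "minkowski x y = fst x * fst y - snd x \<bullet> snd y"

definition Theta_L :: "(real \<times> (real ^ 'n)) set" where
  "Theta_L = {\<theta>. fst \<theta> > sqrt (\<Sum>i\<in>UNIV. (snd \<theta> $ i)\<^sup>2)}"

definition minkowski_norm :: "real \<times> (real ^ 'n) \<Rightarrow> real" where
  "minkowski_norm \<theta> = sqrt (minkowski \<theta> \<theta>)"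

definition hyp_lift :: "(real ^ 'n) \<Rightarrow> real \<times> (real ^ 'n)" where
  "hyp_lift x = (sqrt (1 + (\<Sum>i\<in>UNIV. (x $ i)\<^sup>2)), x)"

text \<open>The standard integral representation of the modified Bessel function of the second kind,
  for real order \<open>\<nu>\<close> and \<open>t > 0\<close>. Among the solutions of the modified Bessel equation it is the one
  asymptotic to \<open>sqrt (\<pi> / (2 * t)) * exp (- t)\<close> at infinity; both properties are proved
  below (\<open>bessel_K_modified_Bessel_equation\<close>, \<open>bessel_K_asymp\<close>).\<close>

definition bessel_K :: "real \<Rightarrow> real \<Rightarrow> real" where
  "bessel_K \<nu> t = (LBINT u:{0..}. exp (- t * cosh u) * cosh (\<nu> * u))"

definition hyp_const :: "nat \<Rightarrow> real \<Rightarrow> real" where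
  "hyp_const d t = t powr ((real d - 1) / 2) /
     (2 * (2 * pi) powr ((real d - 1) / 2) * bessel_K ((real d - 1) / 2) t)"

definition hyp_density :: "real \<times> (real ^ 'n) \<Rightarrow> (real ^ 'n) \<Rightarrow> real" where
  "hyp_density \<theta> x = hyp_const CARD('n) (minkowski_norm \<theta>) *
     (exp (- minkowski \<theta> (hyp_lift x)) / sqrt (1 + (\<Sum>i\<in>UNIV. (x $ i)\<^sup>2)))"

text \<open>The Lebesgue integral with values in the extended reals, so that a divergent integral
  differs from a finite one (the Bochner integral would be \<open>0\<close>). Since \<open>\<infinity> - \<infinity> = \<infinity>\<close> in
  \<^typ>\<open>ereal\<close>, the value is finite only if the positive and the negative part of \<open>g\<close>
  both have a finite integral.\<close>

definition ext_integral :: "'a measure \<Rightarrow> ('a \<Rightarrow> real) \<Rightarrow> ereal" where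
  "ext_integral M g =
     enn2ereal (\<integral>\<^sup>+ x. ennreal (g x) \<partial>M) - enn2ereal (\<integral>\<^sup>+ x. ennreal (- g x) \<partial>M)"

definition f_divergence :: "(real \<Rightarrow> real) \<Rightarrow> ((real ^ 'n) \<Rightarrow> real) \<Rightarrow> ((real ^ 'n) \<Rightarrow> real) \<Rightarrow> ereal" where
  "f_divergence f p q = ext_integral lborel (\<lambda>x. p x * f (q x / p x))"

definition KL_div :: "((real ^ 'n) \<Rightarrow> real) \<Rightarrow> ((real ^ 'n) \<Rightarrow> real) \<Rightarrow> ereal" where
  "KL_div p q = ext_integral lborel (\<lambda>x. p x * ln (p x / q x))"

lemma cosh_ge_quadratic: "1 + u\<^sup>2 / 2 \<le> cosh u" for u :: real
proof -
  have ge: "x \<le> sinh x" if "0 \<le> x" for x :: real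
  proof -
    have "sinh 0 - 0 \<le> sinh x - x"
    proof (rule DERIV_nonneg_imp_nondecreasing[OF that], intro exI conjI)
      show "((\<lambda>x. sinh x - x) has_real_derivative cosh z - 1) (at z)" for z :: real
        by (auto intro!: derivative_eq_intros)
    qed (simp add: cosh_real_ge_1)
    then show ?thesis by simp
  qed
  have "cosh 0 - (1 + 0\<^sup>2 / 2) \<le> cosh \<bar>u\<bar> - (1 + \<bar>u\<bar>\<^sup>2 / 2)"
  proof (rule DERIV_nonneg_imp_nondecreasing[OF abs_ge_zero], intro exI conjI)
    show "((\<lambda>x. cosh x - (1 + x\<^sup>2 / 2)) has_real_derivative sinh z - z) (at z)" for z :: real
      by (auto intro!: derivative_eq_intros)
  qed (simp add: ge)
  then show ?thesis by simp
qed

lemma cosh_le_exp_abs: "cosh x \<le> exp \<bar>x\<bar>" for x :: real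
proof -
  have "exp x + exp (- x) \<le> exp \<bar>x\<bar> + exp \<bar>x\<bar>"
    by (intro add_mono) auto
  then show ?thesis by (simp add: cosh_field_def)
qed

lemma exp_quadratic_le:
  fixes a b u :: real
  assumes "b > 0"
  shows "exp (a * u - b * u\<^sup>2) \<le> exp ((a + 1)\<^sup>2 / (4 * b)) * exp (- u)"
proof -
  have "0 \<le> ((a + 1) - 2 * b * u)\<^sup>2 / (4 * b)" using assms by simp
  also have "\<dots> = (a + 1)\<^sup>2 / (4 * b) - (a + 1) * u + b * u\<^sup>2"
    using assms by (simp add: field_simps power2_eq_square)
  finally show ?thesis by (simp add: exp_add[symmetric] algebra_simps)
qed

lemma bessel_K_integrand_bound:
  fixes t \<nu> u :: real
  assumes "t > 0" "u \<ge> 0"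
  shows "cosh u ^ k * exp (- t * cosh u) * cosh (\<nu> * u)
      \<le> exp ((real k + \<bar>\<nu>\<bar> + 1)\<^sup>2 / (2 * t)) * exp (- u)"
proof -
  have "cosh u ^ k \<le> exp (real k * u)"
    using power_mono[OF cosh_le_exp_abs, of u k] assms by (simp add: exp_of_nat_mult)
  moreover have "exp (- t * cosh u) \<le> exp (- (t / 2) * u\<^sup>2)"
    using mult_left_mono[OF order_trans[OF _ cosh_ge_quadratic], of "u\<^sup>2 / 2" u t] assms by simp
  moreover have "cosh (\<nu> * u) \<le> exp (\<bar>\<nu>\<bar> * u)"
    using cosh_le_exp_abs[of "\<nu> * u"] assms by (simp add: abs_mult)
  ultimately have "cosh u ^ k * exp (- t * cosh u) * cosh (\<nu> * u)
      \<le> exp (real k * u) * exp (- (t / 2) * u\<^sup>2) * exp (\<bar>\<nu>\<bar> * u)"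
    by (intro mult_mono) auto
  also have "\<dots> = exp ((real k + \<bar>\<nu>\<bar>) * u - (t / 2) * u\<^sup>2)"
    by (simp add: exp_add[symmetric] algebra_simps)
  also have "\<dots> \<le> exp ((real k + \<bar>\<nu>\<bar> + 1)\<^sup>2 / (2 * t)) * exp (- u)"
    using exp_quadratic_le[of "t / 2" "real k + \<bar>\<nu>\<bar>" u] assms by simp
  finally show ?thesis .
qed

lemma set_integrable_exp_minus: "set_integrable lborel {0..} (\<lambda>u. C * exp (- u) :: real)"
proof -
  have "integrable lborel (\<lambda>x. exp (- x) * indicator {0..} x :: real)"
    using has_bochner_integral_I0i_power_exp_m'[of 0] by (simp add: has_bochner_integral_iff)
  then have "integrable lborel (\<lambda>x. C * (exp (- x) * indicator {0..} x) :: real)"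
    by (rule integrable_mult_right)
  then show ?thesis
    unfolding set_integrable_def by (simp add: mult_ac)
qed

lemma bessel_K_set_integrable:
  fixes t \<nu> :: real
  assumes "t > 0"
  shows "set_integrable lborel {0..} (\<lambda>u. cosh u ^ k * exp (- t * cosh u) * cosh (\<nu> * u))"
proof (rule set_integrable_bound[OF set_integrable_exp_minus])
  show "set_borel_measurable lborel {0..} (\<lambda>u. cosh u ^ k * exp (- t * cosh u) * cosh (\<nu> * u))"
    unfolding set_borel_measurable_def cosh_field_def by measurable
  show "AE u in lborel. u \<in> {0..} \<longrightarrow> norm (cosh u ^ k * exp (- t * cosh u) * cosh (\<nu> * u))
      \<le> norm (exp ((real k + \<bar>\<nu>\<bar> + 1)\<^sup>2 / (2 * t)) * exp (- u))"
    using bessel_K_integrand_bound[OF assms] by (intro AE_I2) auto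
qed

definition bessel_K_moment :: "nat \<Rightarrow> real \<Rightarrow> real \<Rightarrow> real" where
  "bessel_K_moment k \<nu> t = (LBINT u:{0..}. cosh u ^ k * exp (- t * cosh u) * cosh (\<nu> * u))"

lemma bessel_K_eq_moment: "bessel_K \<nu> = bessel_K_moment 0 \<nu>"
  by (simp add: bessel_K_def bessel_K_moment_def fun_eq_iff)

lemma exp_linear_approx: "\<bar>exp y - 1 - y\<bar> \<le> y\<^sup>2 * exp \<bar>y\<bar>" for y :: real
  using Taylor_exp_field[of y 1] by (simp add: power2_eq_square mult_ac abs_mult diff_diff_eq)

lemma bessel_K_moment_deriv:
  assumes "t > 0"
  shows "(bessel_K_moment k \<nu> has_real_derivative - bessel_K_moment (Suc k) \<nu> t) (at t)"
proof -
  let ?g = "\<lambda>k s u. cosh u ^ k * exp (- s * cosh u) * cosh (\<nu> * u) :: real"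
  let ?F = "\<lambda>k. bessel_K_moment k \<nu>"
  have est: "\<bar>?F k s - ?F k t + (s - t) * ?F (Suc k) t\<bar> \<le> (s - t)\<^sup>2 * ?F (k + 2) (t / 2)"
    if s: "\<bar>s - t\<bar> \<le> t / 2" for s
  proof -
    have "s > 0" using s assms by linarith
    note int = bessel_K_set_integrable[OF \<open>s > 0\<close>] bessel_K_set_integrable[OF assms]
      bessel_K_set_integrable[of "t / 2"]
    have i1: "set_integrable lborel {0..} (\<lambda>u. ?g k s u - ?g k t u)"
      and i2: "set_integrable lborel {0..} (\<lambda>u. (s - t) * ?g (Suc k) t u)"
      by (intro set_integral_diff set_integrable_mult_right int)+
    have eq: "?F k s - ?F k t + (s - t) * ?F (Suc k) t
        = (LBINT u:{0..}. ?g k s u - ?g k t u + (s - t) * ?g (Suc k) t u)"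
      unfolding bessel_K_moment_def
      by (simp only: set_integral_add(2)[OF i1 i2] set_integral_diff(2)[OF int(1,2)]
          set_integral_mult_right)
    have pt: "\<bar>?g k s u - ?g k t u + (s - t) * ?g (Suc k) t u\<bar> \<le> (s - t)\<^sup>2 * ?g (k + 2) (t / 2) u"
      for u
    proof -
      let ?y = "- (s - t) * cosh u"
      have "?g k s u - ?g k t u + (s - t) * ?g (Suc k) t u
          = ?g k t u * (exp ?y - 1 - ?y)"
        by (simp add: algebra_simps exp_add[symmetric])
      also have "\<bar>\<dots>\<bar> = ?g k t u * \<bar>exp ?y - 1 - ?y\<bar>"
        by (simp add: abs_mult)
      also have "\<dots> \<le> ?g k t u * (?y\<^sup>2 * exp \<bar>?y\<bar>)"
        by (intro mult_left_mono exp_linear_approx) simp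
      also have "\<dots> \<le> ?g k t u * (?y\<^sup>2 * exp (t / 2 * cosh u))"
        using s by (intro mult_left_mono) (auto simp: abs_mult abs_minus_commute)
      also have "\<dots> = (s - t)\<^sup>2 * ?g (k + 2) (t / 2) u"
      proof -
        have "exp (- t * cosh u) * exp (t / 2 * cosh u) = exp (- (t / 2) * cosh u)"
          by (simp add: exp_add[symmetric])
        then show ?thesis
          by (simp add: power_mult_distrib power_add mult_ac) (simp add: power2_eq_square algebra_simps)
      qed
      finally show ?thesis .
    qed
    have "\<bar>LBINT u:{0..}. ?g k s u - ?g k t u + (s - t) * ?g (Suc k) t u\<bar>
        \<le> (LBINT u:{0..}. (s - t)\<^sup>2 * ?g (k + 2) (t / 2) u)"
    proof -
      have "set_integrable lborel {0..} (\<lambda>u. ?g k s u - ?g k t u + (s - t) * ?g (Suc k) t u)"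
        by (intro set_integral_add set_integral_diff set_integrable_mult_right int)
      then have "norm (LBINT u:{0..}. ?g k s u - ?g k t u + (s - t) * ?g (Suc k) t u)
          \<le> (LBINT u:{0..}. norm (?g k s u - ?g k t u + (s - t) * ?g (Suc k) t u))"
        by (rule set_integral_norm_bound)
      also have "\<dots> \<le> (LBINT u:{0..}. (s - t)\<^sup>2 * ?g (k + 2) (t / 2) u)"
      proof (rule set_integral_mono)
        show "set_integrable lborel {0..} (\<lambda>u. norm (?g k s u - ?g k t u + (s - t) * ?g (Suc k) t u))"
          by (intro set_integrable_norm set_integral_add set_integral_diff set_integrable_mult_right int)
        show "set_integrable lborel {0..} (\<lambda>u. (s - t)\<^sup>2 * ?g (k + 2) (t / 2) u)"
          using assms by (intro set_integrable_mult_right int) simp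
      qed (simp only: real_norm_def pt)
      finally show ?thesis by simp
    qed
    also have "\<dots> = (s - t)\<^sup>2 * ?F (k + 2) (t / 2)"
      unfolding bessel_K_moment_def by simp
    finally show ?thesis unfolding eq .
  qed
  let ?M = "?F (k + 2) (t / 2)"
  have "((\<lambda>s. (?F k s - ?F k t) / (s - t) + ?F (Suc k) t) \<longlongrightarrow> 0) (at t)"
  proof (rule Lim_null_comparison)
    have "\<forall>\<^sub>F s in at t. \<bar>s - t\<bar> < t / 2 \<and> s \<noteq> t"
      using assms by (auto simp: eventually_at dist_real_def intro!: exI[of _ "t / 2"])
    then show "\<forall>\<^sub>F s in at t. norm ((?F k s - ?F k t) / (s - t) + ?F (Suc k) t) \<le> \<bar>s - t\<bar> * ?M"
    proof eventually_elim
      case (elim s)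
      have "\<bar>s - t\<bar> * norm ((?F k s - ?F k t) / (s - t) + ?F (Suc k) t)
          = \<bar>?F k s - ?F k t + (s - t) * ?F (Suc k) t\<bar>"
        using elim by (simp add: abs_mult[symmetric] field_simps)
      also have "\<dots> \<le> (s - t)\<^sup>2 * ?M" using est[of s] elim by simp
      also have "\<dots> = \<bar>s - t\<bar> * (\<bar>s - t\<bar> * ?M)" by (simp add: power2_eq_square mult.assoc[symmetric])
      finally show ?case
        by (rule mult_left_le_imp_le) (use elim in simp)
    qed
    have "((\<lambda>s. \<bar>s - t\<bar> * ?M) \<longlongrightarrow> \<bar>t - t\<bar> * ?M) (at t)" by (intro tendsto_intros)
    then show "((\<lambda>s. \<bar>s - t\<bar> * ?M) \<longlongrightarrow> 0) (at t)" by simp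
  qed
  then have "((\<lambda>s. (?F k s - ?F k t) / (s - t) + ?F (Suc k) t - ?F (Suc k) t) \<longlongrightarrow> 0 - ?F (Suc k) t) (at t)"
    by (intro tendsto_diff tendsto_const)
  then show ?thesis by (simp add: has_field_derivative_iff)
qed

lemma bessel_K_moment_ODE:
  assumes "t > 0"
  shows "t\<^sup>2 * bessel_K_moment 2 \<nu> t - t * bessel_K_moment 1 \<nu> t - (t\<^sup>2 + \<nu>\<^sup>2) * bessel_K_moment 0 \<nu> t = 0"
proof -
  let ?g = "\<lambda>k u. cosh u ^ k * exp (- t * cosh u) * cosh (\<nu> * u) :: real"
  let ?h = "\<lambda>u. t\<^sup>2 * ?g 2 u - t * ?g 1 u - (t\<^sup>2 + \<nu>\<^sup>2) * ?g 0 u"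
  let ?H = "\<lambda>u. - (exp (- t * cosh u) * (t * sinh u * cosh (\<nu> * u) + \<nu> * sinh (\<nu> * u)))"
  note int = bessel_K_set_integrable[OF assms]
  have inth: "set_integrable lborel {0..} ?h"
    by (intro set_integral_diff set_integrable_mult_right int)
  have "(?H has_real_derivative ?h u) (at u)" for u
  proof -
    have "(?H has_real_derivative exp (- t * cosh u) *
        (t\<^sup>2 * (sinh u)\<^sup>2 * cosh (\<nu> * u) - t * cosh u * cosh (\<nu> * u) - \<nu>\<^sup>2 * cosh (\<nu> * u))) (at u)"
      by (auto intro!: derivative_eq_intros simp: algebra_simps power2_eq_square)
    moreover have "(sinh u)\<^sup>2 = (cosh u)\<^sup>2 - 1"
      by (simp add: cosh_square_eq)
    ultimately show ?thesis
      by (simp add: algebra_simps)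
  qed
  then have der: "(?H has_vector_derivative ?h u) (at u within S)" for u S
    by (simp only: has_real_derivative_iff_has_vector_derivative has_vector_derivative_at_within)
  have "(LBINT u:{0..b}. ?h u) = ?H b - ?H 0" if "b \<ge> 0" for b
    unfolding set_lebesgue_integral_def
    by (rule integral_FTC_atLeastAtMost[OF that der]) (intro continuous_intros)
  then have ev: "\<forall>\<^sub>F b in at_top. ?H b = (LBINT u:{0..b}. ?h u)"
    by (intro eventually_at_top_linorderI[of 0]) auto
  have "((\<lambda>b. LBINT u:{0..b}. ?h u) \<longlongrightarrow> (LBINT u:{0..}. ?h u)) at_top"
    by (rule tendsto_set_lebesgue_integral_at_top[OF _ inth]) auto
  moreover have "((\<lambda>b. LBINT u:{0..b}. ?h u) \<longlongrightarrow> 0) at_top"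
  proof (rule Lim_transform_eventually[OF _ ev], rule Lim_null_comparison)
    let ?C = "\<lambda>k. exp ((real k + \<bar>\<nu>\<bar> + 1)\<^sup>2 / (2 * t))"
    show "\<forall>\<^sub>F u in at_top. norm (?H u) \<le> t * (?C 1 * exp (- u)) + \<bar>\<nu>\<bar> * (?C 0 * exp (- u))"
    proof (rule eventually_at_top_linorderI[of 0])
      fix u :: real assume u: "u \<ge> 0"
      have ab: "\<bar>sinh x\<bar> \<le> cosh x" for x :: real
        using sinh_le_cosh_real[of "\<bar>x\<bar>"] by simp
      have "norm (?H u) \<le> t * (\<bar>sinh u\<bar> * exp (- t * cosh u) * cosh (\<nu> * u))
          + \<bar>\<nu>\<bar> * (exp (- t * cosh u) * \<bar>sinh (\<nu> * u)\<bar>)"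
        using assms abs_triangle_ineq[of "t * (sinh u * exp (- t * cosh u) * cosh (\<nu> * u))"
            "\<nu> * (exp (- t * cosh u) * sinh (\<nu> * u))"]
        by (simp add: abs_mult algebra_simps)
      also have "\<dots> \<le> t * ?g 1 u + \<bar>\<nu>\<bar> * ?g 0 u"
        using assms by (intro add_mono mult_left_mono) (auto intro!: mult_right_mono ab)
      also have "\<dots> \<le> t * (?C 1 * exp (- u)) + \<bar>\<nu>\<bar> * (?C 0 * exp (- u))"
        using assms u by (intro add_mono mult_left_mono bessel_K_integrand_bound) auto
      finally show "norm (?H u) \<le> t * (?C 1 * exp (- u)) + \<bar>\<nu>\<bar> * (?C 0 * exp (- u))" .
    qed
    have e: "((\<lambda>u::real. exp (- u)) \<longlongrightarrow> 0) at_top"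
      by real_asymp
    show "((\<lambda>u. t * (?C 1 * exp (- u)) + \<bar>\<nu>\<bar> * (?C 0 * exp (- u))) \<longlongrightarrow> 0) at_top"
      by (rule tendsto_eq_intros e refl | simp)+
  qed
  ultimately have "(LBINT u:{0..}. ?h u) = 0"
    by (rule tendsto_unique[rotated]) simp
  moreover have "(LBINT u:{0..}. ?h u) = t\<^sup>2 * bessel_K_moment 2 \<nu> t - t * bessel_K_moment 1 \<nu> t
      - (t\<^sup>2 + \<nu>\<^sup>2) * bessel_K_moment 0 \<nu> t"
    unfolding bessel_K_moment_def
    by (subst set_integral_diff(2), (intro set_integral_diff set_integrable_mult_right int)+)+
       (simp only: set_integral_mult_right)
  ultimately show ?thesis by simp
qed

lemma bessel_K_modified_Bessel_equation:
  assumes "t > 0"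
  shows "bessel_K \<nu> differentiable (at t)" "deriv (bessel_K \<nu>) differentiable (at t)"
    "t\<^sup>2 * deriv (deriv (bessel_K \<nu>)) t + t * deriv (bessel_K \<nu>) t - (t\<^sup>2 + \<nu>\<^sup>2) * bessel_K \<nu> t = 0"
proof -
  have d1: "(bessel_K \<nu> has_real_derivative - bessel_K_moment 1 \<nu> s) (at s)" if "s > 0" for s
    using bessel_K_moment_deriv[OF that, of 0 \<nu>] by (simp add: bessel_K_eq_moment)
  then show "bessel_K \<nu> differentiable (at t)"
    using assms real_differentiable_def[of "bessel_K \<nu>" t] by blast
  have ev: "\<forall>\<^sub>F s in nhds t. deriv (bessel_K \<nu>) s = - bessel_K_moment 1 \<nu> s"
    using eventually_nhds_in_open[of "{0<..}" t] assms
    by (auto elim!: eventually_mono intro!: DERIV_imp_deriv d1[simplified])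
  have "((\<lambda>s. - bessel_K_moment 1 \<nu> s) has_real_derivative bessel_K_moment 2 \<nu> t) (at t)"
    using DERIV_minus[OF bessel_K_moment_deriv[OF assms, of 1 \<nu>]] by (simp add: numeral_2_eq_2)
  then have d2: "(deriv (bessel_K \<nu>) has_real_derivative bessel_K_moment 2 \<nu> t) (at t)"
    using DERIV_cong_ev[OF refl ev refl] by simp
  then show "deriv (bessel_K \<nu>) differentiable (at t)"
    using real_differentiable_def by blast
  show "t\<^sup>2 * deriv (deriv (bessel_K \<nu>)) t + t * deriv (bessel_K \<nu>) t - (t\<^sup>2 + \<nu>\<^sup>2) * bessel_K \<nu> t = 0"
    using bessel_K_moment_ODE[OF assms, of \<nu>] DERIV_imp_deriv[OF d1[OF assms]] DERIV_imp_deriv[OF d2]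
    by (simp add: bessel_K_eq_moment)
qed

lemma bessel_K_asymp: "bessel_K \<nu> \<sim>[at_top] (\<lambda>t. sqrt (pi / (2 * t)) * exp (- t))"
proof -
  let ?s = "\<lambda>t v. indicator {0..} v * (exp (- t * (cosh (v / sqrt t) - 1)) * cosh (\<nu> * (v / sqrt t))) :: real"
  let ?f = "\<lambda>v. indicator {0..} v * exp (- (v\<^sup>2 / 2)) :: real"
  have scale: "integral\<^sup>L lborel (?s t) = sqrt t * exp t * bessel_K \<nu> t" if t: "t > 0" for t
  proof -
    have "integral\<^sup>L lborel (?s t) = \<bar>sqrt t\<bar> *\<^sub>R integral\<^sup>L lborel (\<lambda>u. ?s t (0 + sqrt t * u))"
      by (rule lborel_integral_real_affine) (use t in simp)
    also have "(\<lambda>u. ?s t (0 + sqrt t * u))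
        = (\<lambda>u. exp t * (indicator {0..} u *\<^sub>R (exp (- t * cosh u) * cosh (\<nu> * u))))"
    proof
      fix u :: real
      have "sqrt t * u / sqrt t = u" and "indicator {0..} (sqrt t * u) = (indicator {0..} u :: real)"
        using t by (auto simp: indicator_def zero_le_mult_iff)
      moreover have "exp (- t * (cosh u - 1)) = exp t * exp (- t * cosh u)"
        by (simp add: exp_add[symmetric] algebra_simps)
      ultimately show "?s t (0 + sqrt t * u)
          = exp t * (indicator {0..} u *\<^sub>R (exp (- t * cosh u) * cosh (\<nu> * u)))"
        by simp
    qed
    also have "integral\<^sup>L lborel \<dots> = exp t * bessel_K \<nu> t"
      by (simp only: bessel_K_def set_lebesgue_integral_def integral_mult_right_zero)
    finally show ?thesis
      using t by simp
  qed
  have gauss: "integral\<^sup>L lborel ?f = sqrt (pi / 2)"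
  proof -
    have "integral\<^sup>L lborel ?f = \<bar>sqrt 2\<bar> *\<^sub>R integral\<^sup>L lborel (\<lambda>u. ?f (0 + sqrt 2 * u))"
      by (rule lborel_integral_real_affine) simp
    also have "(\<lambda>u. ?f (0 + sqrt 2 * u)) = (\<lambda>u. indicator {0..} u *\<^sub>R exp (- u\<^sup>2))"
      by (auto simp: fun_eq_iff indicator_def zero_le_mult_iff power_mult_distrib)
    also have "integral\<^sup>L lborel \<dots> = sqrt pi / 2"
      using gaussian_moment_0 by (simp add: has_bochner_integral_iff)
    also have "\<bar>sqrt 2\<bar> *\<^sub>R (sqrt pi / 2) = sqrt (pi / 2)"
      by (simp add: real_sqrt_divide field_simps)
    finally show ?thesis .
  qed
  let ?C = "exp ((\<bar>\<nu>\<bar> + 1)\<^sup>2 / (4 * (1 / 2)))"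
  have "((\<lambda>t. integral\<^sup>L lborel (?s t)) \<longlongrightarrow> integral\<^sup>L lborel ?f) at_top"
  proof (rule integral_dominated_convergence_at_top[where w = "\<lambda>v. indicator {0..} v *\<^sub>R (?C * exp (- v))"])
    show "?f \<in> borel_measurable lborel" by measurable
    show "?s t \<in> borel_measurable lborel" for t
      unfolding cosh_field_def by measurable
    show "integrable lborel (\<lambda>v. indicator {0..} v *\<^sub>R (?C * exp (- v)))"
      using set_integrable_exp_minus[of ?C] by (simp only: set_integrable_def)
    have "((\<lambda>t. exp (- t * (cosh (v / sqrt t) - 1)) * cosh (\<nu> * (v / sqrt t))) \<longlongrightarrow> exp (- (v\<^sup>2 / 2)) * 1) at_top" for v
    proof (intro tendsto_mult tendsto_exp)
      show "((\<lambda>t. - t * (cosh (v / sqrt t) - 1)) \<longlongrightarrow> - (v\<^sup>2 / 2)) at_top"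
        unfolding cosh_field_def power2_eq_square by real_asymp
      show "((\<lambda>t. cosh (\<nu> * (v / sqrt t))) \<longlongrightarrow> 1) at_top"
        unfolding cosh_field_def by real_asymp
    qed
    then show "AE v in lborel. ((\<lambda>t. ?s t v) \<longlongrightarrow> ?f v) at_top"
      by (intro AE_I2 tendsto_mult tendsto_const) simp
    have "norm (?s t v) \<le> indicator {0..} v *\<^sub>R (?C * exp (- v))" if t: "t \<ge> 1" for t v
    proof (cases "v \<ge> 0")
      case True
      have "v / sqrt t \<le> v" using t True by (simp add: divide_le_eq mult_le_cancel_left1)
      have "cosh (\<nu> * (v / sqrt t)) \<le> exp (\<bar>\<nu>\<bar> * (v / sqrt t))"
        using cosh_le_exp_abs[of "\<nu> * (v / sqrt t)"] True t by (simp add: abs_mult)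
      also have "\<dots> \<le> exp (\<bar>\<nu>\<bar> * v)"
        using mult_left_mono[OF \<open>v / sqrt t \<le> v\<close>, of "\<bar>\<nu>\<bar>"] by (simp only: exp_le_cancel_iff abs_ge_zero)
      finally have 1: "cosh (\<nu> * (v / sqrt t)) \<le> exp (\<bar>\<nu>\<bar> * v)" .
      have "v\<^sup>2 / 2 = t * ((v / sqrt t)\<^sup>2 / 2)" using t by (simp add: power_divide)
      also have "\<dots> \<le> t * (cosh (v / sqrt t) - 1)"
        using t cosh_ge_quadratic[of "v / sqrt t"] by (intro mult_left_mono) auto
      finally have 2: "exp (- t * (cosh (v / sqrt t) - 1)) \<le> exp (- (1 / 2) * v\<^sup>2)" by simp
      have "exp (- t * (cosh (v / sqrt t) - 1)) * cosh (\<nu> * (v / sqrt t)) \<le> exp (- (1 / 2) * v\<^sup>2) * exp (\<bar>\<nu>\<bar> * v)"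
        by (intro mult_mono 1 2) auto
      also have "\<dots> = exp (\<bar>\<nu>\<bar> * v - 1 / 2 * v\<^sup>2)" by (simp add: exp_add[symmetric])
      also have "\<dots> \<le> ?C * exp (- v)" by (rule exp_quadratic_le) simp
      finally show ?thesis using True by (simp add: abs_mult)
    qed simp
    then show "\<forall>\<^sub>F t in at_top. AE v in lborel. norm (?s t v) \<le> indicator {0..} v *\<^sub>R (?C * exp (- v))"
      by (intro eventually_at_top_linorderI[of 1] AE_I2)
  qed
  then have lim: "((\<lambda>t. integral\<^sup>L lborel (?s t) / sqrt (pi / 2)) \<longlongrightarrow> sqrt (pi / 2) / sqrt (pi / 2)) at_top"
    unfolding gauss by (intro tendsto_divide tendsto_const) auto
  have "\<forall>\<^sub>F t in at_top. integral\<^sup>L lborel (?s t) / sqrt (pi / 2) = bessel_K \<nu> t / (sqrt (pi / (2 * t)) * exp (- t))"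
    using eventually_gt_at_top[of 0]
  proof eventually_elim
    case (elim t)
    then show ?case
      unfolding scale[OF elim] by (simp add: real_sqrt_divide real_sqrt_mult exp_minus field_simps)
  qed
  from Lim_transform_eventually[OF lim this]
  have "((\<lambda>t. bessel_K \<nu> t / (sqrt (pi / (2 * t)) * exp (- t))) \<longlongrightarrow> 1) at_top" by simp
  then show ?thesis by (rule asymp_equivI')
qed

end

theory Submission
  imports Defs
begin

text \<open>The weights \<open>w\<^sub>\<theta> x = exp (- [\<theta>, x~]) / x~\<^sub>0\<close> form an exponential family, so each integrand is a
  combination of weights: \<open>sqrt (w\<^sub>\<theta> * w\<^sub>\<theta>')\<close> is the weight at \<open>(\<theta> + \<theta>') / 2\<close> and \<open>w\<^sub>\<theta>'\<^sup>2 / w\<^sub>\<theta>\<close> the one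
  at \<open>2 \<theta>' - \<theta>\<close>. Everything then follows from the total mass \<open>2 (2 \<pi> / \<bar>\<theta>\<bar>)\<^sup>\<nu> K\<^sub>\<nu> \<bar>\<theta>\<bar>\<close> of \<open>w\<^sub>\<theta>\<close>, where
  \<open>\<nu> = (d - 1) / 2\<close>. It is computed by writing \<open>exp (- a * s) / s\<close> as a mixture of the Gaussians
  \<open>exp (- s\<^sup>2 * exp u / 2)\<close>, exchanging the integrals, and integrating over \<open>x\<close>; no polar coordinates or Lorentz
  transformations are needed. The logarithm in the Kullback--Leibler divergence brings in the
  first moments of \<open>w\<^sub>\<theta>\<close>, which are derivatives of the mass.\<close>

section \<open>Gaussian and Bessel integrals\<close>

text \<open>The substitution rule on each compact \<open>{- real n..real n}\<close> passes to the
  limit by monotone convergence on both sides. The images increase because \<open>g\<close> is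
  monotone, and by the intermediate value theorem they exhaust \<open>range g\<close>.\<close>

lemma nn_integral_substitution_UNIV:
  fixes f :: "real \<Rightarrow> ennreal" and g g' :: "real \<Rightarrow> real"
  assumes f [measurable]: "f \<in> borel_measurable borel"
    and g: "\<And>x. (g has_real_derivative g' x) (at x)"
    and g'_cont: "continuous_on UNIV g'"
    and g'_nonneg: "\<And>x. g' x \<ge> 0"
  shows "(\<integral>\<^sup>+x. f (g x) * g' x \<partial>lborel) = (\<integral>\<^sup>+x. f x * indicator (range g) x \<partial>lborel)"
proof -
  have g_cont: "continuous_on UNIV g"
    using g by (meson DERIV_continuous_on has_field_derivative_at_within)
  have mono: "g x \<le> g y" if "x \<le> y" for x y
    by (rule DERIV_nonneg_imp_nondecreasing[OF that]) (use g g'_nonneg in blast)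
  have [measurable]: "g \<in> borel_measurable borel" "g' \<in> borel_measurable borel"
    using g_cont g'_cont by (auto intro: borel_measurable_continuous_onI)
  have UN1: "(\<Union>n. {- real n..real n}) = UNIV"
  proof (intro set_eqI iffI UNIV_I)
    fix x :: real
    obtain n where "\<bar>x\<bar> \<le> real n" using real_arch_simple by blast
    then show "x \<in> (\<Union>n. {- real n..real n})" by (auto simp: abs_le_iff intro!: exI[of _ n])
  qed
  have UN2: "(\<Union>n. {g (- real n)..g (real n)}) = range g"
  proof (intro equalityI subsetI)
    fix y assume "y \<in> (\<Union>n. {g (- real n)..g (real n)})"
    then obtain n where "g (- real n) \<le> y" "y \<le> g (real n)" by auto
    then show "y \<in> range g"
      using IVT'[of g "- real n" y "real n"] continuous_on_subset[OF g_cont] by auto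
  next
    fix y assume "y \<in> range g"
    then obtain x where x: "y = g x" by blast
    obtain n where "\<bar>x\<bar> \<le> real n" using real_arch_simple by blast
    then show "y \<in> (\<Union>n. {g (- real n)..g (real n)})"
      unfolding x by (auto simp: abs_le_iff intro!: exI[of _ n] mono)
  qed
  have sup: "(SUP n. indicator (A n) x) = (indicator (\<Union>n. A n) x :: ennreal)" for A :: "nat \<Rightarrow> real set" and x
  proof (cases "x \<in> (\<Union>n. A n)")
    case True
    then obtain k where "x \<in> A k" by blast
    then have "1 \<le> (SUP n. indicator (A n) x :: ennreal)"
      by (intro SUP_upper2[of k]) auto
    then show ?thesis
      using True by (intro antisym SUP_least) (auto split: split_indicator)
  qed simp
  have "(\<integral>\<^sup>+x. f (g x) * g' x \<partial>lborel)
      = (\<integral>\<^sup>+x. (SUP n. f (g x) * g' x * indicator {- real n..real n} x) \<partial>lborel)"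
    by (simp add: SUP_mult_left_ennreal[symmetric] sup UN1)
  also have "\<dots> = (SUP n. \<integral>\<^sup>+x. f (g x) * g' x * indicator {- real n..real n} x \<partial>lborel)"
    by (rule nn_integral_monotone_convergence_SUP)
      (auto simp: incseq_def le_fun_def intro!: mult_left_mono split: split_indicator)
  also have "\<dots> = (SUP n. \<integral>\<^sup>+x. f x * indicator {g (- real n)..g (real n)} x \<partial>lborel)"
  proof (rule SUP_cong[OF refl])
    fix n
    show "(\<integral>\<^sup>+x. f (g x) * g' x * indicator {- real n..real n} x \<partial>lborel)
        = (\<integral>\<^sup>+x. f x * indicator {g (- real n)..g (real n)} x \<partial>lborel)"
    \<comment> \<open>The compact rule needs a proper interval; for \<open>n = 0\<close> both sides
      are integrals over a single point, hence 0.\<close>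
    proof (cases "n = 0")
      case False
      then show ?thesis
        using continuous_on_subset[OF g'_cont]
        by (intro nn_integral_substitution_aux[symmetric] g g'_nonneg) auto
    qed (simp add: nn_integral_indicator_singleton')
  qed
  also have "\<dots> = (\<integral>\<^sup>+x. (SUP n. f x * indicator {g (- real n)..g (real n)} x) \<partial>lborel)"
  proof (rule nn_integral_monotone_convergence_SUP[symmetric])
    have "indicator {g (- real n)..g (real n)} x \<le> (indicator {g (- real (Suc n))..g (real (Suc n))} x :: ennreal)" for n x
      using mono[of "- real (Suc n)" "- real n"] mono[of "real n" "real (Suc n)"]
      by (auto simp: indicator_def simp del: of_nat_Suc)
    then show "incseq (\<lambda>n x. f x * indicator {g (- real n)..g (real n)} x)"
      by (intro incseq_SucI le_funI mult_left_mono) simp_all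
  qed measurable
  also have "\<dots> = (\<integral>\<^sup>+x. f x * indicator (range g) x \<partial>lborel)"
    by (simp add: SUP_mult_left_ennreal[symmetric] sup UN2)
  finally show ?thesis .
qed

text \<open>Completing the square turns the integrand into a constant times the normal density with
  mean \<open>c / w\<close> and variance \<open>1 / w\<close>.\<close>

lemma nn_integral_gaussian:
  fixes c w :: real
  assumes "w > 0"
  shows "(\<integral>\<^sup>+y. ennreal (exp (c * y - w * y\<^sup>2 / 2)) \<partial>lborel) = ennreal (sqrt (2 * pi / w) * exp (c\<^sup>2 / (2 * w)))"
proof -
  let ?N = "normal_density (c / w) (1 / sqrt w)"
  let ?C = "sqrt (2 * pi / w) * exp (c\<^sup>2 / (2 * w))"
  have "exp (c * y - w * y\<^sup>2 / 2) = ?C * ?N y" for y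
  proof -
    have "c * y - w * y\<^sup>2 / 2 = c\<^sup>2 / (2 * w) + - (y - c / w)\<^sup>2 / (2 * (1 / sqrt w)\<^sup>2)"
      using assms by (simp add: power_divide field_simps power2_eq_square)
    then show ?thesis
      unfolding normal_density_def exp_add[symmetric] using assms by (simp add: power_divide flip: exp_add)
  qed
  then have "(\<integral>\<^sup>+y. ennreal (exp (c * y - w * y\<^sup>2 / 2)) \<partial>lborel) = (\<integral>\<^sup>+y. ennreal (?C * ?N y) \<partial>lborel)"
    by simp
  also have "\<dots> = ennreal (\<integral>y. ?C * ?N y \<partial>lborel)"
    using assms by (intro nn_integral_eq_integral integrable_mult_right) auto
  also have "\<dots> = ennreal ?C"
    using assms by simp
  finally show ?thesis .
qed

text \<open>The exponential factors over the coordinates in \<open>Basis\<close>, which reduces the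
  integral to a product of one-dimensional ones.\<close>

lemma nn_integral_gaussian_euclidean:
  fixes v :: "'a::euclidean_space" and w :: real
  assumes "w > 0"
  shows "(\<integral>\<^sup>+x. ennreal (exp (v \<bullet> x - w * (x \<bullet> x) / 2)) \<partial>lborel)
    = ennreal ((2 * pi / w) powr (real DIM('a) / 2) * exp (v \<bullet> v / (2 * w)))"
proof -
  let ?f = "\<lambda>b y. exp ((v \<bullet> b) * y - w * y\<^sup>2 / 2)"
  have "exp (v \<bullet> x - w * (x \<bullet> x) / 2) = (\<Prod>b\<in>Basis. ?f b (x \<bullet> b))" for x
    by (simp add: exp_sum[symmetric] euclidean_inner[of _ x] sum_subtractf sum_distrib_left
        sum_divide_distrib power2_eq_square)
  then have "(\<integral>\<^sup>+x. ennreal (exp (v \<bullet> x - w * (x \<bullet> x) / 2)) \<partial>lborel)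
      = (\<integral>\<^sup>+x. (\<Prod>b\<in>Basis. ennreal (?f b (x \<bullet> b))) \<partial>lborel)"
    by (simp add: prod_ennreal)
  also have "\<dots> = (\<Prod>b\<in>Basis. \<integral>\<^sup>+y. ennreal (?f b y) \<partial>lborel)"
    by (rule nn_integral_lborel_prod) auto
  also have "\<dots> = ennreal (\<Prod>b\<in>Basis. sqrt (2 * pi / w) * exp ((v \<bullet> b)\<^sup>2 / (2 * w)))"
    using assms by (simp add: nn_integral_gaussian prod_ennreal)
  also have "(\<Prod>b\<in>Basis. sqrt (2 * pi / w) * exp ((v \<bullet> b)\<^sup>2 / (2 * w)))
      = (2 * pi / w) powr (real DIM('a) / 2) * exp (v \<bullet> v / (2 * w))"
    using assms
    by (simp add: prod.distrib exp_sum[symmetric] sum_divide_distrib[symmetric] euclidean_inner[of v v]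
        power2_eq_square powr_half_sqrt[symmetric] powr_realpow[symmetric] powr_powr)
  finally show ?thesis .
qed

lemma borel_measurable_cosh [measurable (raw)]:
  fixes f :: "'a \<Rightarrow> real"
  assumes "f \<in> borel_measurable M"
  shows "(\<lambda>x. cosh (f x)) \<in> borel_measurable M"
  unfolding cosh_field_def using assms by measurable

section \<open>Exponential-cosh integrals over the line and their relation to
  \<open>bessel_K\<close>\<close>

text \<open>The reflection of \<open>u\<close> to \<open>- u\<close> fixes \<open>cosh u\<close> and
  flips the sign of \<open>\<nu> * u\<close>; averaging the two forms produces
  \<open>cosh (\<nu> * u)\<close>.\<close>

lemma nn_integral_exp_cosh_symm:
  "(\<integral>\<^sup>+u. ennreal (exp (\<nu> * u - t * cosh u)) \<partial>lborel)
    = (\<integral>\<^sup>+u. ennreal (cosh (\<nu> * u) * exp (- t * cosh u)) \<partial>lborel)" (is "?A = ?B")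
proof -
  have "?A = (\<integral>\<^sup>+u. ennreal (exp (- \<nu> * u - t * cosh u)) \<partial>lborel)"
    by (subst nn_integral_real_affine[where c = "-1" and t = 0]) auto
  then have "?A + ?A = (\<integral>\<^sup>+u. ennreal (exp (\<nu> * u - t * cosh u)) + ennreal (exp (- \<nu> * u - t * cosh u)) \<partial>lborel)"
    by (subst nn_integral_add) auto
  also have "\<dots> = (\<integral>\<^sup>+u. 2 * ennreal (cosh (\<nu> * u) * exp (- t * cosh u)) \<partial>lborel)"
  proof (intro nn_integral_cong)
    fix u :: real
    have "exp (\<nu> * u - t * cosh u) + exp (- \<nu> * u - t * cosh u) = 2 * (cosh (\<nu> * u) * exp (- t * cosh u))"
      by (simp add: cosh_field_def[of "\<nu> * u"] exp_diff exp_minus field_simps)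
    then show "ennreal (exp (\<nu> * u - t * cosh u)) + ennreal (exp (- \<nu> * u - t * cosh u))
        = 2 * ennreal (cosh (\<nu> * u) * exp (- t * cosh u))"
      by (simp add: ennreal_plus[symmetric] ennreal_mult''[symmetric] flip: ennreal_numeral del: ennreal_plus)
  qed
  also have "\<dots> = 2 * ?B"
    by (rule nn_integral_cmult) measurable
  finally have "2 * ?A = 2 * ?B" by (simp add: mult_2)
  then show ?thesis by (simp add: ennreal_mult_cancel_left)
qed


text \<open>Translating \<open>u\<close> by \<open>ln (q / p)\<close> balances the two exponentials:
  both get the coefficient \<open>p * q\<close>, so they add up to
  \<open>2 * p * q * cosh u\<close>. The prefactor is what the translation leaves of
  \<open>exp (\<nu> * u)\<close>.\<close>

lemma nn_integral_exp_shift: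
  fixes p q \<nu> :: real
  assumes "p > 0" "q > 0"
  shows "(\<integral>\<^sup>+u. ennreal (exp (\<nu> * u - (p\<^sup>2 * exp u + q\<^sup>2 * exp (- u)) / 2)) \<partial>lborel)
    = ennreal ((q / p) powr \<nu>) * (\<integral>\<^sup>+u. ennreal (cosh (\<nu> * u) * exp (- (p * q) * cosh u)) \<partial>lborel)"
proof -
  let ?l = "ln (q / p)"
  have "exp (\<nu> * (?l + 1 * u) - (p\<^sup>2 * exp (?l + 1 * u) + q\<^sup>2 * exp (- (?l + 1 * u))) / 2)
      = (q / p) powr \<nu> * exp (\<nu> * u - p * q * cosh u)" for u
  proof -
    have "p\<^sup>2 * exp (?l + 1 * u) = p * q * exp u"
      using assms by (simp add: exp_add power2_eq_square)
    moreover have "q\<^sup>2 * exp (- (?l + 1 * u)) = p * q * exp (- u)"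
      using assms by (simp add: exp_diff exp_minus power2_eq_square field_simps)
    ultimately have "\<nu> * (?l + 1 * u) - (p\<^sup>2 * exp (?l + 1 * u) + q\<^sup>2 * exp (- (?l + 1 * u))) / 2
        = \<nu> * ?l + (\<nu> * u - p * q * cosh u)"
      by (simp add: cosh_field_def algebra_simps add_divide_distrib)
    then show ?thesis
      using assms by (simp only: exp_add) (simp add: powr_def)
  qed
  then have "(\<integral>\<^sup>+u. ennreal (exp (\<nu> * u - (p\<^sup>2 * exp u + q\<^sup>2 * exp (- u)) / 2)) \<partial>lborel)
      = (\<integral>\<^sup>+u. ennreal ((q / p) powr \<nu>) * ennreal (exp (\<nu> * u - p * q * cosh u)) \<partial>lborel)"
    by (subst nn_integral_real_affine[where c = 1 and t = ?l])
      (auto simp: ennreal_mult[symmetric])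
  also have "\<dots> = ennreal ((q / p) powr \<nu>) * (\<integral>\<^sup>+u. ennreal (exp (\<nu> * u - p * q * cosh u)) \<partial>lborel)"
    by (rule nn_integral_cmult) measurable
  finally show ?thesis
    by (simp only: nn_integral_exp_cosh_symm)
qed

text \<open>The substitution \<open>y = 2 * sinh (u / 2)\<close> has derivative
  \<open>cosh (u / 2)\<close> and gives \<open>cosh u = 1 + y\<^sup>2 / 2\<close>, so a Gaussian
  integral remains. This is the closed form of \<open>2 * bessel_K (1 / 2) r\<close>.\<close>

lemma nn_integral_cosh_half:
  fixes r :: real
  assumes "r > 0"
  shows "(\<integral>\<^sup>+u. ennreal (cosh (u / 2) * exp (- r * cosh u)) \<partial>lborel) = ennreal (sqrt (2 * pi / r) * exp (- r))"
proof -
  let ?g = "\<lambda>u::real. 2 * sinh (u / 2)"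
  let ?f = "\<lambda>y. ennreal (exp (- r)) * ennreal (exp (0 * y - r * y\<^sup>2 / 2))"
  have cosh: "cosh u = 1 + (?g u)\<^sup>2 / 2" for u :: real
    using cosh_double[of "u / 2"] cosh_square_eq[of "u / 2"] by (simp add: power_mult_distrib)
  have "range ?g = UNIV"
  proof (rule surjI)
    show "?g (2 * arsinh (y / 2)) = y" for y by (simp add: sinh_arsinh_real)
  qed
  then have "(\<integral>\<^sup>+u. ?f (?g u) * ennreal (cosh (u / 2)) \<partial>lborel) = (\<integral>\<^sup>+y. ?f y \<partial>lborel)"
    by (subst nn_integral_substitution_UNIV)
      (auto intro!: derivative_eq_intros continuous_intros)
  moreover have "?f (?g u) * ennreal (cosh (u / 2)) = ennreal (cosh (u / 2) * exp (- r * cosh u))" for u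
    by (simp add: cosh ennreal_mult[symmetric] exp_add[symmetric] algebra_simps)
  ultimately have "(\<integral>\<^sup>+u. ennreal (cosh (u / 2) * exp (- r * cosh u)) \<partial>lborel) = (\<integral>\<^sup>+y. ?f y \<partial>lborel)"
    by simp
  also have "\<dots> = ennreal (exp (- r)) * (\<integral>\<^sup>+y. ennreal (exp (0 * y - r * y\<^sup>2 / 2)) \<partial>lborel)"
    by (rule nn_integral_cmult) measurable
  also have "\<dots> = ennreal (sqrt (2 * pi / r) * exp (- r))"
    using assms by (simp only: nn_integral_gaussian) (simp add: ennreal_mult[symmetric] mult.commute)
  finally show ?thesis .
qed

text \<open>This is \<open>nn_integral_exp_shift\<close> at order \<open>1 / 2\<close>, where the
  cosh integral is elementary. Under the integral \<open>s\<close> enters only through its square,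
  so the root in \<open>s = sqrt (1 + x \<bullet> x)\<close> will disappear.\<close>

lemma exp_minus_mult_subordination:
  fixes a s :: real
  assumes "a > 0" "s > 0"
  shows "(\<integral>\<^sup>+u. ennreal (exp (1 / 2 * u - (s\<^sup>2 * exp u + a\<^sup>2 * exp (- u)) / 2)) \<partial>lborel)
    = ennreal (sqrt (2 * pi) * (exp (- a * s) / s))"
proof -
  have "(\<integral>\<^sup>+u. ennreal (exp (1 / 2 * u - (s\<^sup>2 * exp u + a\<^sup>2 * exp (- u)) / 2)) \<partial>lborel)
      = ennreal ((a / s) powr (1 / 2) * (sqrt (2 * pi / (s * a)) * exp (- (s * a))))"
    using assms nn_integral_cosh_half[of "s * a"]
    by (subst nn_integral_exp_shift) (simp_all add: ennreal_mult)
  also have "(a / s) powr (1 / 2) * sqrt (2 * pi / (s * a)) = sqrt (2 * pi) / s"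
  proof -
    have "(a / s) powr (1 / 2) * sqrt (2 * pi / (s * a)) = sqrt ((a / s) * (2 * pi / (s * a)))"
      using assms by (simp add: powr_half_sqrt flip: real_sqrt_mult)
    also have "(a / s) * (2 * pi / (s * a)) = 2 * pi / s\<^sup>2"
      using assms by (simp add: power2_eq_square)
    finally show ?thesis using assms by (simp add: real_sqrt_divide)
  qed
  then have "(a / s) powr (1 / 2) * (sqrt (2 * pi / (s * a)) * exp (- (s * a))) = sqrt (2 * pi) * (exp (- a * s) / s)"
    by (simp add: mult.commute[of s a] flip: mult.assoc)
  finally show ?thesis .
qed

text \<open>The integrand is even, so the line gives twice the half-line integral that defines
  \<open>bessel_K\<close>; integrability identifies the Bochner integral with the nonnegative
  one.\<close>

lemma nn_integral_bessel_K:
  assumes "t > 0"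
  shows "(\<integral>\<^sup>+u. ennreal (cosh (\<nu> * u) * exp (- t * cosh u)) \<partial>lborel) = ennreal (2 * bessel_K \<nu> t)"
proof -
  let ?f = "\<lambda>u. cosh (\<nu> * u) * exp (- t * cosh u)"
  have int: "integrable lborel (\<lambda>u. ?f u * indicator {0..} u)"
    using bessel_K_set_integrable[OF assms, of 0 \<nu>] by (simp add: set_integrable_def mult_ac)
  have half: "(\<integral>\<^sup>+u. ennreal (?f u) * indicator {0..} u \<partial>lborel) = ennreal (bessel_K \<nu> t)"
  proof -
    have "(\<integral>\<^sup>+u. ennreal (?f u) * indicator {0..} u \<partial>lborel) = (\<integral>\<^sup>+u. ennreal (?f u * indicator {0..} u) \<partial>lborel)"
      by (intro nn_integral_cong) (auto split: split_indicator)
    also have "\<dots> = ennreal (bessel_K \<nu> t)"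
      unfolding bessel_K_def set_lebesgue_integral_def using int
      by (subst nn_integral_eq_integral) (auto intro!: AE_I2 arg_cong[where f = ennreal] simp: mult_ac)
    finally show ?thesis .
  qed
  have "(\<integral>\<^sup>+u. ennreal (?f u) \<partial>lborel)
      = (\<integral>\<^sup>+u. ennreal (?f u) * indicator {0..} u + ennreal (?f u) * indicator {..<0} u \<partial>lborel)"
    by (intro nn_integral_cong) (auto split: split_indicator)
  also have "\<dots> = (\<integral>\<^sup>+u. ennreal (?f u) * indicator {0..} u \<partial>lborel) + (\<integral>\<^sup>+u. ennreal (?f u) * indicator {..<0} u \<partial>lborel)"
    by (rule nn_integral_add) measurable
  also have "(\<integral>\<^sup>+u. ennreal (?f u) * indicator {..<0} u \<partial>lborel) = (\<integral>\<^sup>+u. ennreal (?f u) * indicator {0<..} u \<partial>lborel)"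
    by (subst nn_integral_real_affine[where c = "-1" and t = 0])
       (auto intro!: nn_integral_cong split: split_indicator)
  also have "\<dots> = (\<integral>\<^sup>+u. ennreal (?f u) * indicator {0..} u \<partial>lborel)"
    using AE_lborel_singleton[of "0::real"]
    by (intro nn_integral_cong_AE) (auto split: split_indicator)
  finally have "(\<integral>\<^sup>+u. ennreal (?f u) \<partial>lborel) = ennreal (bessel_K \<nu> t) + ennreal (bessel_K \<nu> t)"
    unfolding half .
  moreover have "bessel_K \<nu> t \<ge> 0"
    unfolding bessel_K_def set_lebesgue_integral_def by (intro Bochner_Integration.integral_nonneg) simp
  ultimately show ?thesis by (simp flip: ennreal_plus)
qed

section \<open>The mass of the hyperboloid weights\<close>

text \<open>The weight of the parameter \<open>(a, v)\<close>, stated over any Euclidean space. The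
  signature of the Minkowski product makes the spatial term positive.\<close>

definition hyp_kernel :: "real \<Rightarrow> 'a::euclidean_space \<Rightarrow> 'a \<Rightarrow> real" where
  "hyp_kernel a v x = exp (v \<bullet> x - a * sqrt (1 + x \<bullet> x)) / sqrt (1 + x \<bullet> x)"

lemma hyp_kernel_measurable [measurable]: "hyp_kernel a v \<in> borel_measurable borel"
  unfolding hyp_kernel_def[abs_def] by measurable

text \<open>Subordination makes the integrand Gaussian in \<open>x\<close> with precision
  \<open>exp u\<close>. Exchanging the integrals, the \<open>x\<close>-integral contributes
  \<open>exp ((v \<bullet> v) * exp (- u) / 2)\<close>, which lowers \<open>a\<^sup>2\<close> to the
  Minkowski square \<open>a\<^sup>2 - v \<bullet> v\<close>.\<close>

lemma nn_integral_hyp_kernel: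
  fixes v :: "'a::euclidean_space"
  defines "\<nu> \<equiv> (real DIM('a) - 1) / 2"
  assumes a: "a > 0"
  shows "(\<integral>\<^sup>+x. ennreal (hyp_kernel a v x) \<partial>lborel)
    = ennreal ((2 * pi) powr \<nu>) *
      (\<integral>\<^sup>+u. ennreal (exp (- \<nu> * u - (exp u + (a\<^sup>2 - v \<bullet> v) * exp (- u)) / 2)) \<partial>lborel)"
proof -
  let ?h = "\<lambda>(x::'a) u. (1 / sqrt (2 * pi)) * exp (1 / 2 * u - (exp u + a\<^sup>2 * exp (- u)) / 2) *
    exp (v \<bullet> x - exp u * (x \<bullet> x) / 2)"
  have 1: "ennreal (hyp_kernel a v x) = (\<integral>\<^sup>+u. ennreal (?h x u) \<partial>lborel)" for x
  proof -
    let ?s = "sqrt (1 + x \<bullet> x)"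
    have s: "?s > 0" "?s\<^sup>2 = 1 + x \<bullet> x"
      by (simp_all add: add_pos_nonneg)
    have c: "exp (v \<bullet> x) / sqrt (2 * pi) \<ge> 0"
      by simp
    have "?h x u = (exp (v \<bullet> x) / sqrt (2 * pi)) * exp (1 / 2 * u - (?s\<^sup>2 * exp u + a\<^sup>2 * exp (- u)) / 2)" for u
      unfolding s(2) by (simp add: field_simps flip: exp_add)
    then have "(\<integral>\<^sup>+u. ennreal (?h x u) \<partial>lborel) = (\<integral>\<^sup>+u. ennreal (exp (v \<bullet> x) / sqrt (2 * pi)) *
        ennreal (exp (1 / 2 * u - (?s\<^sup>2 * exp u + a\<^sup>2 * exp (- u)) / 2)) \<partial>lborel)"
      by (simp only: ennreal_mult'[OF c])
    also have "\<dots> = ennreal (exp (v \<bullet> x) / sqrt (2 * pi)) * ennreal (sqrt (2 * pi) * (exp (- a * ?s) / ?s))"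
      by (subst nn_integral_cmult) (measurable, simp only: exp_minus_mult_subordination[OF a s(1)])
    also have "\<dots> = ennreal (hyp_kernel a v x)"
      using s(1) by (simp add: hyp_kernel_def exp_diff exp_minus field_simps flip: ennreal_mult)
    finally show ?thesis ..
  qed
  have 2: "(\<integral>\<^sup>+x. ennreal (?h x u) \<partial>lborel)
      = ennreal ((2 * pi) powr \<nu>) * ennreal (exp (- \<nu> * u - (exp u + (a\<^sup>2 - v \<bullet> v) * exp (- u)) / 2))" for u
  proof -
    let ?c = "(1 / sqrt (2 * pi)) * exp (1 / 2 * u - (exp u + a\<^sup>2 * exp (- u)) / 2)"
    have "(\<integral>\<^sup>+x. ennreal (?h x u) \<partial>lborel) = (\<integral>\<^sup>+x. ennreal ?c * ennreal (exp (v \<bullet> x - exp u * (x \<bullet> x) / 2)) \<partial>lborel)"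
      by (subst ennreal_mult') simp_all
    also have "\<dots> = ennreal ?c * ennreal ((2 * pi / exp u) powr (real DIM('a) / 2) * exp (v \<bullet> v / (2 * exp u)))"
      by (subst nn_integral_cmult) (measurable, simp only: nn_integral_gaussian_euclidean[OF exp_gt_zero])
    also have "\<dots> = ennreal (?c * ((2 * pi / exp u) powr (real DIM('a) / 2) * exp (v \<bullet> v / (2 * exp u))))"
      by (simp flip: ennreal_mult)
    also have "?c * ((2 * pi / exp u) powr (real DIM('a) / 2) * exp (v \<bullet> v / (2 * exp u)))
        = (2 * pi) powr \<nu> * exp (- \<nu> * u - (exp u + (a\<^sup>2 - v \<bullet> v) * exp (- u)) / 2)"
    proof -
      \<comment> \<open>The Gaussian gives \<open>2 * pi\<close> and \<open>exp (- u)\<close> the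
        power \<open>DIM('a) / 2\<close>. The factor \<open>exp (u / 2) / sqrt (2 * pi)\<close> from
        subordination lowers both powers by \<open>1 / 2\<close>, to \<open>\<nu>\<close>.\<close>
      have A: "(2 * pi / exp u) powr (real DIM('a) / 2) = (2 * pi) powr (real DIM('a) / 2) * exp (- (real DIM('a) / 2) * u)"
        by (simp add: powr_divide exp_powr_real exp_minus field_simps)
      have B: "(2 * pi) powr \<nu> = (2 * pi) powr (real DIM('a) / 2) * (1 / sqrt (2 * pi))"
        by (simp add: \<nu>_def diff_divide_distrib powr_diff powr_half_sqrt)
      have C: "v \<bullet> v / (2 * exp u) = (v \<bullet> v) * exp (- u) / 2"
        by (simp add: exp_minus field_simps)
      have D: "- \<nu> * u - (exp u + (a\<^sup>2 - v \<bullet> v) * exp (- u)) / 2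
          = (1 / 2 * u - (exp u + a\<^sup>2 * exp (- u)) / 2) + - (real DIM('a) / 2) * u + (v \<bullet> v) * exp (- u) / 2"
        by (simp add: \<nu>_def field_simps)
      show ?thesis unfolding A B C D exp_add by simp
    qed
    finally show ?thesis by (simp add: ennreal_mult)
  qed
  have "(\<integral>\<^sup>+x. ennreal (hyp_kernel a v x) \<partial>lborel) = (\<integral>\<^sup>+u. \<integral>\<^sup>+x. ennreal (?h x u) \<partial>lborel \<partial>lborel)"
    unfolding 1 by (rule lborel_pair.Fubini'[symmetric]) measurable
  also have "\<dots> = ennreal ((2 * pi) powr \<nu>) *
      (\<integral>\<^sup>+u. ennreal (exp (- \<nu> * u - (exp u + (a\<^sup>2 - v \<bullet> v) * exp (- u)) / 2)) \<partial>lborel)"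
    unfolding 2 by (rule nn_integral_cmult) measurable
  finally show ?thesis .
qed

text \<open>For \<open>t > 0\<close> and \<open>\<nu> = (d - 1) / 2\<close> this is the reciprocal
  of the normalising constant \<open>hyp_const d t\<close>.\<close>

definition hyp_mass :: "real \<Rightarrow> real \<Rightarrow> real" where
  "hyp_mass \<nu> t = 2 * (2 * pi / t) powr \<nu> * bessel_K \<nu> t"

text \<open>A nonpositive value becomes 0 under \<open>ennreal\<close>, so a strictly positive
  function would have integral 0 over the line and vanish almost everywhere.\<close>

lemma bessel_K_pos:
  assumes "t > 0"
  shows "bessel_K \<nu> t > 0"
proof (rule ccontr)
  assume "\<not> bessel_K \<nu> t > 0"
  then have "(\<integral>\<^sup>+u. ennreal (cosh (\<nu> * u) * exp (- t * cosh u)) \<partial>lborel) = 0"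
    using nn_integral_bessel_K[OF assms, of \<nu>] by (simp add: ennreal_neg)
  then have "AE u in lborel. ennreal (cosh (\<nu> * u) * exp (- t * cosh u)) = 0"
    by (subst (asm) nn_integral_0_iff_AE) auto
  moreover have "ennreal (cosh (\<nu> * u) * exp (- t * cosh u)) \<noteq> 0" for u
    using cosh_real_pos[of "\<nu> * u"] by (simp add: not_le)
  ultimately have "AE u in (lborel :: real measure). False"
    by (simp only: simp_thms)
  then show False
    by (simp add: ae_filter_eq_bot_iff flip: trivial_limit_def)
qed

lemma hyp_mass_pos: "t > 0 \<Longrightarrow> hyp_mass \<nu> t > 0"
  by (simp add: hyp_mass_def bessel_K_pos)

text \<open>Inside the cone the Minkowski square is some \<open>t\<^sup>2\<close> with
  \<open>t > 0\<close>, so \<open>nn_integral_exp_shift\<close> applies with \<open>p = 1\<close>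
  and \<open>q = t\<close>. The order that comes out is \<open>- \<nu>\<close>, which evenness of
  \<open>cosh\<close> turns into \<open>\<nu>\<close>.\<close>

lemma has_bochner_integral_hyp_kernel:
  fixes v :: "'a::euclidean_space"
  assumes "norm v < a"
  shows "has_bochner_integral lborel (hyp_kernel a v)
    (hyp_mass ((real DIM('a) - 1) / 2) (sqrt (a\<^sup>2 - v \<bullet> v)))"
proof -
  define \<nu> t where "\<nu> = (real DIM('a) - 1) / 2" and "t = sqrt (a\<^sup>2 - v \<bullet> v)"
  have a: "a > 0" using assms norm_ge_zero[of v] by linarith
  have "v \<bullet> v < a\<^sup>2"
    using assms by (simp add: power_strict_mono flip: power2_norm_eq_inner)
  then have t: "t > 0" "t\<^sup>2 = a\<^sup>2 - v \<bullet> v"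
    by (simp_all add: t_def)
  have "(\<integral>\<^sup>+x. ennreal (hyp_kernel a v x) \<partial>lborel) = ennreal ((2 * pi) powr \<nu>) *
      (\<integral>\<^sup>+u. ennreal (exp (- \<nu> * u - (1\<^sup>2 * exp u + t\<^sup>2 * exp (- u)) / 2)) \<partial>lborel)"
    using nn_integral_hyp_kernel[OF a, of v] by (simp add: \<nu>_def t(2))
  also have "\<dots> = ennreal ((2 * pi) powr \<nu>) * (ennreal ((t / 1) powr - \<nu>) *
      ennreal (2 * bessel_K (- \<nu>) t))"
    using nn_integral_bessel_K[OF t(1), of "- \<nu>"] t(1) by (subst nn_integral_exp_shift) simp_all
  also have "bessel_K (- \<nu>) t = bessel_K \<nu> t"
    by (simp add: bessel_K_def)
  also have "ennreal ((2 * pi) powr \<nu>) * (ennreal ((t / 1) powr - \<nu>) * ennreal (2 * bessel_K \<nu> t))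
      = ennreal (hyp_mass \<nu> t)"
    using t(1) bessel_K_pos[OF t(1), of \<nu>]
    by (simp add: hyp_mass_def powr_divide powr_minus_divide mult_ac flip: ennreal_mult)
  finally show ?thesis
    using hyp_mass_pos[OF t(1), of \<nu>] unfolding \<nu>_def[symmetric] t_def[symmetric]
    by (intro has_bochner_integral_nn_integral) (auto simp: hyp_kernel_def[abs_def])
qed

lemma nn_integral_hyp_kernel_infinite:
  fixes v :: "'a::euclidean_space"
  assumes "a \<le> norm v"
  shows "(\<integral>\<^sup>+x. ennreal (hyp_kernel a v x) \<partial>lborel) = \<infinity>" (is "?I = _")
  \<comment> \<open>Compare with \<open>b > norm v\<close>, where \<open>b\<^sup>2 - v \<bullet> v = exp (- n)\<close>: the \<open>u\<close>-integral is bounded below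
    by a multiple of the length \<open>n\<close> of \<open>{- n..0}\<close>.\<close>
proof (rule ccontr)
  define \<nu> where "\<nu> = (real DIM('a) - 1) / 2"
  have \<nu>: "\<nu> \<ge> 0" using DIM_positive[where 'a='a] by (simp add: \<nu>_def Suc_le_eq)
  let ?C = "(2 * pi) powr \<nu> * exp (- 1)"
  have "?C * real n \<le> enn2real ?I" if fin: "?I \<noteq> \<infinity>" for n
  proof -
    define b where "b = sqrt (v \<bullet> v + exp (- real n))"
    have b2: "b\<^sup>2 - v \<bullet> v = exp (- real n)" by (simp add: b_def add_nonneg_nonneg)
    have b: "b > 0" by (simp add: b_def add_nonneg_pos)
    have "norm v \<le> b" unfolding b_def norm_eq_sqrt_inner by simp
    then have "a \<le> b" using assms by linarith
    have "ennreal ?C * ennreal (real n)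
        = ennreal ((2 * pi) powr \<nu>) * (\<integral>\<^sup>+u. ennreal (exp (- 1)) * indicator {- real n..0} u \<partial>lborel)"
      by (simp add: nn_integral_cmult_indicator ennreal_mult mult.assoc)
    also have "\<dots> \<le> ennreal ((2 * pi) powr \<nu>) *
        (\<integral>\<^sup>+u. ennreal (exp (- \<nu> * u - (exp u + exp (- real n) * exp (- u)) / 2)) \<partial>lborel)"
    proof (intro mult_left_mono nn_integral_mono)
      fix u :: real
      \<comment> \<open>Both exponentials are at most 1 on this interval, so their half-sum is too,
        and \<open>- \<nu> * u\<close> is nonnegative; hence the constant
        \<open>exp (- 1)\<close>.\<close>
      have "- 1 \<le> - \<nu> * u - (exp u + exp (- real n) * exp (- u)) / 2" if "- real n \<le> u" "u \<le> 0"
      proof -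
        have "exp u \<le> 1" "exp (- real n) * exp (- u) \<le> 1"
          using that by (simp_all flip: exp_add)
        then have "(exp u + exp (- real n) * exp (- u)) / 2 \<le> (1 + 1) / 2"
          by (intro divide_right_mono add_mono) simp_all
        then have "(exp u + exp (- real n) * exp (- u)) / 2 \<le> 1"
          by simp
        moreover have "- \<nu> * u \<ge> 0"
          using \<nu> that by (simp add: mult_nonneg_nonpos)
        moreover have "- 1 \<le> p - q" if "q \<le> 1" "p \<ge> 0" for p q :: real
          using that by linarith
        ultimately show ?thesis by blast
      qed
      then show "ennreal (exp (- 1)) * indicator {- real n..0} u
          \<le> ennreal (exp (- \<nu> * u - (exp u + exp (- real n) * exp (- u)) / 2))"
        by (auto simp: indicator_def intro!: ennreal_leI)
    qed simp
    also have "\<dots> = (\<integral>\<^sup>+x. ennreal (hyp_kernel b v x) \<partial>lborel)"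
      by (simp add: nn_integral_hyp_kernel[OF b] b2 \<nu>_def)
    \<comment> \<open>The kernel decreases in its first parameter.\<close>
    also have "\<dots> \<le> ?I"
      using \<open>a \<le> b\<close> by (intro nn_integral_mono ennreal_leI)
        (auto simp: hyp_kernel_def intro!: divide_right_mono mult_right_mono)
    finally have "ennreal (?C * real n) \<le> ?I"
      by (simp add: ennreal_mult)
    then show ?thesis
      using fin by (metis enn2real_ennreal enn2real_mono exp_ge_zero infinity_ennreal_def less_top
          mult_nonneg_nonneg of_nat_0_le_iff powr_ge_zero)
  qed
  moreover assume "?I \<noteq> \<infinity>"
  ultimately have *: "?C * real n \<le> enn2real ?I" for n by blast
  obtain n where "enn2real ?I / ?C < real n" using reals_Archimedean2 by blast
  then show False using *[of n] by (simp add: divide_less_eq mult.commute)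
qed

section \<open>Weights indexed by Minkowski vectors, and their algebra\<close>

definition hyp_weight :: "real \<times> (real ^ 'n) \<Rightarrow> real ^ 'n \<Rightarrow> real" where
  "hyp_weight \<theta> x = exp (- minkowski \<theta> (hyp_lift x)) / fst (hyp_lift x)"

lemma sum_power2_eq_inner: "(\<Sum>i\<in>UNIV. (x $ i)\<^sup>2) = x \<bullet> x" for x :: "real ^ 'n"
  by (simp add: inner_vec_def power2_eq_square)

lemma hyp_lift_pos: "fst (hyp_lift x) > 0"
  by (simp add: hyp_lift_def add_pos_nonneg sum_nonneg)

lemma hyp_weight_pos: "hyp_weight \<theta> x > 0"
  by (simp add: hyp_weight_def hyp_lift_pos)

lemma hyp_weight_eq_kernel: "hyp_weight \<theta> = hyp_kernel (fst \<theta>) (snd \<theta>)"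
  by (simp add: fun_eq_iff hyp_weight_def hyp_kernel_def minkowski_def hyp_lift_def sum_power2_eq_inner)

lemma hyp_weight_measurable [measurable]: "hyp_weight \<theta> \<in> borel_measurable borel"
  unfolding hyp_weight_eq_kernel by measurable

lemma Theta_L_iff: "\<theta> \<in> Theta_L \<longleftrightarrow> norm (snd \<theta>) < fst \<theta>"
  by (simp add: Theta_L_def sum_power2_eq_inner norm_eq_sqrt_inner)

lemma minkowski_self_pos: "\<theta> \<in> Theta_L \<Longrightarrow> minkowski \<theta> \<theta> > 0"
  by (simp add: Theta_L_iff minkowski_def power_strict_mono flip: power2_norm_eq_inner power2_eq_square)

lemma minkowski_norm_pos: "\<theta> \<in> Theta_L \<Longrightarrow> minkowski_norm \<theta> > 0"
  by (simp add: minkowski_norm_def minkowski_self_pos)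

lemma minkowski_norm_scaleR: "minkowski_norm (c *\<^sub>R \<theta>) = \<bar>c\<bar> * minkowski_norm \<theta>"
proof -
  have "minkowski (c *\<^sub>R \<theta>) (c *\<^sub>R \<theta>) = c\<^sup>2 * minkowski \<theta> \<theta>"
    by (simp add: minkowski_def algebra_simps power2_eq_square)
  then show ?thesis by (simp add: minkowski_norm_def real_sqrt_mult)
qed

lemma minkowski_add_left: "minkowski (\<theta> + \<eta>) y = minkowski \<theta> y + minkowski \<eta> y"
  and minkowski_diff_left: "minkowski (\<theta> - \<eta>) y = minkowski \<theta> y - minkowski \<eta> y"
  and minkowski_scaleR_left: "minkowski (c *\<^sub>R \<theta>) y = c * minkowski \<theta> y"
  by (simp_all add: minkowski_def algebra_simps)

text \<open>By the triangle inequality; together with scaling it keeps the midpoint parameter of the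
  Hellinger divergence in the cone.\<close>

lemma Theta_L_add: "\<theta> \<in> Theta_L \<Longrightarrow> \<eta> \<in> Theta_L \<Longrightarrow> \<theta> + \<eta> \<in> Theta_L"
  unfolding Theta_L_iff using norm_triangle_ineq[of "snd \<theta>" "snd \<eta>"] by simp

lemma Theta_L_scaleR: "\<theta> \<in> Theta_L \<Longrightarrow> c > 0 \<Longrightarrow> c *\<^sub>R \<theta> \<in> Theta_L"
  by (simp add: Theta_L_iff)

lemma has_bochner_integral_hyp_weight:
  fixes \<theta> :: "real \<times> (real ^ 'n)"
  assumes "\<theta> \<in> Theta_L"
  shows "has_bochner_integral lborel (hyp_weight \<theta>)
    (hyp_mass ((real CARD('n) - 1) / 2) (minkowski_norm \<theta>))"
  using has_bochner_integral_hyp_kernel[of "snd \<theta>" "fst \<theta>"] assms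
  by (simp add: hyp_weight_eq_kernel Theta_L_iff minkowski_norm_def minkowski_def power2_eq_square)

lemma nn_integral_hyp_weight_infinite:
  "\<theta> \<notin> Theta_L \<Longrightarrow> (\<integral>\<^sup>+x. ennreal (hyp_weight \<theta> x) \<partial>lborel) = \<infinity>"
  unfolding hyp_weight_eq_kernel Theta_L_iff by (rule nn_integral_hyp_kernel_infinite) simp

lemma hyp_density_eq:
  fixes \<theta> :: "real \<times> (real ^ 'n)"
  assumes "\<theta> \<in> Theta_L"
  shows "hyp_density \<theta> x = hyp_weight \<theta> x / hyp_mass ((real CARD('n) - 1) / 2) (minkowski_norm \<theta>)"
  using minkowski_norm_pos[OF assms] by (simp add: hyp_density_def hyp_weight_def hyp_const_def hyp_mass_def hyp_lift_def powr_divide mult_ac)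

lemma hyp_weight_add_scaleR: "hyp_weight (\<theta> + c *\<^sub>R \<eta>) x = hyp_weight \<theta> x * exp (- c * minkowski \<eta> (hyp_lift x))"
  by (simp add: hyp_weight_def minkowski_add_left minkowski_scaleR_left exp_diff exp_minus divide_simps)

lemma sqrt_hyp_weight_mult: "sqrt (hyp_weight \<theta> x * hyp_weight \<theta>' x) = hyp_weight ((1 / 2) *\<^sub>R (\<theta> + \<theta>')) x"
proof (rule real_sqrt_unique)
  show "(hyp_weight ((1 / 2) *\<^sub>R (\<theta> + \<theta>')) x)\<^sup>2 = hyp_weight \<theta> x * hyp_weight \<theta>' x"
    by (simp add: hyp_weight_def power_divide minkowski_add_left minkowski_scaleR_left
        power2_eq_square field_simps flip: exp_add)
qed (simp add: hyp_weight_pos less_imp_le)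

text \<open>The exponents combine linearly and one factor \<open>1 / fst (hyp_lift x)\<close>
  survives. The new parameter may lie outside the cone, which is the source of the infinite
  chi-squared case.\<close>

lemma hyp_weight_power2_divide: "(hyp_weight \<theta>' x)\<^sup>2 / hyp_weight \<theta> x = hyp_weight (2 *\<^sub>R \<theta>' - \<theta>) x"
proof -
  have "exp (- minkowski (2 *\<^sub>R \<theta>' - \<theta>) (hyp_lift x)) * exp (- minkowski \<theta> (hyp_lift x))
      = (exp (- minkowski \<theta>' (hyp_lift x)))\<^sup>2"
    by (simp add: power2_eq_square minkowski_diff_left minkowski_scaleR_left flip: exp_add)
  then show ?thesis
    using hyp_lift_pos[of x] by (simp add: hyp_weight_def power_divide power2_eq_square field_simps)
qed

section \<open>Extended-valued integrals of integrable functions\<close>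

text \<open>Integrability makes the positive and negative parts finite, so the subtraction in
  \<open>ereal\<close> is that of the reals.\<close>

lemma ext_integral_eq_integral:
  assumes "integrable M g"
  shows "ext_integral M g = ereal (integral\<^sup>L M g)"
proof -
  have "(\<integral>\<^sup>+x. ennreal (g x) \<partial>M) < \<infinity>" "(\<integral>\<^sup>+x. ennreal (- g x) \<partial>M) < \<infinity>"
    using assms by (auto simp: real_integrable_def less_top)
  then show ?thesis
    unfolding ext_integral_def real_lebesgue_integral_def[OF assms]
    by (cases "\<integral>\<^sup>+x. ennreal (g x) \<partial>M" ; cases "\<integral>\<^sup>+x. ennreal (- g x) \<partial>M") (auto simp: less_top)
qed

lemma ext_integral_has_bochner_integral: "has_bochner_integral M g I \<Longrightarrow> ext_integral M g = ereal I"
  using ext_integral_eq_integral by (metis has_bochner_integral_iff)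

section \<open>First moments of the weights as derivatives of the mass\<close>

text \<open>The product rule, written as mass times logarithmic derivative so that the mass later
  cancels against the normalisation of the density.\<close>

lemma hyp_mass_has_real_derivative:
  assumes t: "t > 0"
  shows "(hyp_mass \<nu> has_real_derivative hyp_mass \<nu> t * (deriv (bessel_K \<nu>) t / bessel_K \<nu> t - \<nu> / t)) (at t)"
proof -
  have K: "(bessel_K \<nu> has_real_derivative deriv (bessel_K \<nu>) t) (at t)"
    using bessel_K_modified_Bessel_equation(1)[OF t] by (simp add: DERIV_deriv_iff_real_differentiable)
  have p: "((\<lambda>t. (2 * pi / t) powr \<nu>) has_real_derivative - \<nu> / t * (2 * pi / t) powr \<nu>) (at t)"
  proof -
    have "((\<lambda>t. 2 * pi / t) has_real_derivative - (2 * pi) / t\<^sup>2) (at t)"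
      using t by (auto intro!: derivative_eq_intros simp: power2_eq_square)
    then have "((\<lambda>t. (2 * pi / t) powr \<nu>) has_real_derivative
        \<nu> * (2 * pi / t) powr (\<nu> - of_nat 1) * (- (2 * pi) / t\<^sup>2)) (at t)"
      using t by (intro DERIV_fun_powr) auto
    moreover have "(2 * pi / t) powr (\<nu> - of_nat 1) = (2 * pi / t) powr \<nu> * (t / (2 * pi))"
      using t by (simp add: powr_diff)
    ultimately show ?thesis
      using t by (simp add: power2_eq_square mult_ac)
  qed
  show ?thesis
    unfolding hyp_mass_def[abs_def]
    using t bessel_K_pos[OF t, of \<nu>]
    by (intro DERIV_cong[OF DERIV_mult[OF DERIV_cmult[OF p] K]]) (simp add: field_simps)
qed

text \<open>Under the root stands a quadratic polynomial in \<open>\<epsilon>\<close> whose linear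
  coefficient is \<open>2 * minkowski \<theta> \<eta>\<close>.\<close>

lemma minkowski_norm_has_real_derivative:
  assumes "\<theta> \<in> Theta_L"
  shows "((\<lambda>\<epsilon>. minkowski_norm (\<theta> + \<epsilon> *\<^sub>R \<eta>)) has_real_derivative minkowski \<theta> \<eta> / minkowski_norm \<theta>) (at 0)"
proof -
  have eq: "minkowski_norm (\<theta> + \<epsilon> *\<^sub>R \<eta>) = sqrt (minkowski \<theta> \<theta> + 2 * \<epsilon> * minkowski \<theta> \<eta> + \<epsilon>\<^sup>2 * minkowski \<eta> \<eta>)" for \<epsilon>
    by (simp add: minkowski_norm_def minkowski_def algebra_simps power2_eq_square inner_commute)
  show ?thesis
    unfolding eq using minkowski_self_pos[OF assms]
    by (auto intro!: derivative_eq_intros simp: minkowski_norm_def field_simps)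
qed

lemma eventually_add_scaleR_Theta_L:
  assumes "\<theta> \<in> Theta_L"
  shows "\<forall>\<^sub>F \<epsilon> in nhds 0. \<theta> + \<epsilon> *\<^sub>R \<eta> \<in> Theta_L"
proof -
  have "((\<lambda>\<epsilon>. fst \<theta> + \<epsilon> * fst \<eta> - norm (snd \<theta> + \<epsilon> *\<^sub>R snd \<eta>)) \<longlongrightarrow> fst \<theta> + 0 * fst \<eta> - norm (snd \<theta> + 0 *\<^sub>R snd \<eta>)) (nhds 0)"
    by (intro tendsto_intros filterlim_ident)
  then have "\<forall>\<^sub>F \<epsilon> in nhds 0. fst \<theta> + \<epsilon> * fst \<eta> - norm (snd \<theta> + \<epsilon> *\<^sub>R snd \<eta>) > 0"
    by (rule order_tendstoD) (use assms in \<open>simp add: Theta_L_iff\<close>)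
  then show ?thesis by (simp add: Theta_L_iff)
qed

text \<open>Formally, differentiating the mass of
  \<open>hyp_weight (\<theta> + \<epsilon> *\<^sub>R \<eta>)\<close> at
  \<open>\<epsilon> = 0\<close> brings down \<open>- minkowski \<eta> (hyp_lift x)\<close>. The
  value is therefore minus the directional derivative given by the chain rule.\<close>

lemma has_bochner_integral_hyp_weight_minkowski:
  fixes \<theta> \<eta> :: "real \<times> (real ^ 'n)"
  defines "\<nu> \<equiv> (real CARD('n) - 1) / 2"
  assumes \<theta>: "\<theta> \<in> Theta_L"
  shows "has_bochner_integral lborel (\<lambda>x. hyp_weight \<theta> x * minkowski \<eta> (hyp_lift x))
    (- (hyp_mass \<nu> (minkowski_norm \<theta>) *
      (deriv (bessel_K \<nu>) (minkowski_norm \<theta>) / bessel_K \<nu> (minkowski_norm \<theta>) - \<nu> / minkowski_norm \<theta>) *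
      (minkowski \<theta> \<eta> / minkowski_norm \<theta>)))"
proof -
  let ?t = "minkowski_norm \<theta>"
  let ?D = "hyp_mass \<nu> ?t * (deriv (bessel_K \<nu>) ?t / bessel_K \<nu> ?t - \<nu> / ?t) * (minkowski \<theta> \<eta> / ?t)"
  let ?y = "\<lambda>x. minkowski \<eta> (hyp_lift x)"
  let ?Z = "\<lambda>\<epsilon>. hyp_mass \<nu> (minkowski_norm (\<theta> + \<epsilon> *\<^sub>R \<eta>))"
  note Z = has_bochner_integral_hyp_weight[where 'n='n, folded \<nu>_def]
  obtain e where e: "e > 0" and Th: "\<And>\<epsilon>. \<bar>\<epsilon>\<bar> < e \<Longrightarrow> \<theta> + \<epsilon> *\<^sub>R \<eta> \<in> Theta_L"
    using eventually_add_scaleR_Theta_L[OF \<theta>, of \<eta>]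
    unfolding eventually_nhds_metric dist_real_def by auto
  have [measurable]: "?y \<in> borel_measurable borel"
    unfolding minkowski_def hyp_lift_def sum_power2_eq_inner by simp
  have int: "integrable lborel (\<lambda>x. hyp_weight \<theta> x * ?y x)"
  proof (rule Bochner_Integration.integrable_bound)
    \<comment> \<open>Any step strictly inside \<open>(0, e)\<close> keeps both
      \<open>\<theta> + ?c *\<^sub>R \<eta>\<close> and
      \<open>\<theta> - ?c *\<^sub>R \<eta>\<close> in the cone. The linear factor is dominated by
      the two exponentials that turn the weight of \<open>\<theta>\<close> into theirs.\<close>
    let ?c = "e / 2"
    show "integrable lborel (\<lambda>x. (hyp_weight (\<theta> + ?c *\<^sub>R \<eta>) x + hyp_weight (\<theta> + (- ?c) *\<^sub>R \<eta>) x) / ?c)"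
      using Z[OF Th[of ?c]] Z[OF Th[of "- ?c"]] e
      by (intro Bochner_Integration.integrable_divide Bochner_Integration.integrable_add) (auto simp: has_bochner_integral_iff)
    show "AE x in lborel. norm (hyp_weight \<theta> x * ?y x)
        \<le> norm ((hyp_weight (\<theta> + ?c *\<^sub>R \<eta>) x + hyp_weight (\<theta> + (- ?c) *\<^sub>R \<eta>) x) / ?c)"
    proof (rule AE_I2)
      fix x
      have *: "\<bar>z\<bar> \<le> exp (- z) + exp z" for z :: real
        using exp_ge_add_one_self[of z] exp_ge_add_one_self[of "- z"] exp_gt_zero[of z] exp_gt_zero[of "- z"] by linarith
      have "\<bar>?y x\<bar> \<le> (exp (- (?c * ?y x)) + exp (?c * ?y x)) / ?c"
        using *[of "?c * ?y x"] e by (simp add: abs_mult field_simps)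
      then have "hyp_weight \<theta> x * \<bar>?y x\<bar> \<le> hyp_weight \<theta> x * ((exp (- (?c * ?y x)) + exp (?c * ?y x)) / ?c)"
        by (intro mult_left_mono) (simp_all add: hyp_weight_pos less_imp_le)
      also have "\<dots> = (hyp_weight (\<theta> + ?c *\<^sub>R \<eta>) x + hyp_weight (\<theta> + (- ?c) *\<^sub>R \<eta>) x) / ?c"
        unfolding hyp_weight_add_scaleR by (simp add: distrib_left)
      also have "\<dots> \<le> norm \<dots>"
        unfolding real_norm_def by (rule abs_ge_self)
      finally show "norm (hyp_weight \<theta> x * ?y x)
          \<le> norm ((hyp_weight (\<theta> + ?c *\<^sub>R \<eta>) x + hyp_weight (\<theta> + (- ?c) *\<^sub>R \<eta>) x) / ?c)"
        using hyp_weight_pos[of \<theta> x] by (simp only: real_norm_def abs_mult abs_of_pos)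
    qed
  qed simp
  let ?I = "\<integral>x. hyp_weight \<theta> x * ?y x \<partial>lborel"
  have "(?Z has_real_derivative ?D) (at 0)"
  proof -
    have "minkowski_norm (\<theta> + 0 *\<^sub>R \<eta>) = ?t" by simp
    then show ?thesis
      using DERIV_chain2[OF _ minkowski_norm_has_real_derivative[OF \<theta>, of \<eta>], of "hyp_mass \<nu>"]
        hyp_mass_has_real_derivative[OF minkowski_norm_pos[OF \<theta>], of \<nu>] by simp
  qed
  then have "((\<lambda>\<epsilon>. ?Z \<epsilon> + \<epsilon> * ?I) has_real_derivative ?D + ?I) (at 0)"
    by (auto intro!: derivative_eq_intros)
  moreover have "?Z 0 + 0 * ?I \<le> ?Z \<epsilon> + \<epsilon> * ?I" if "\<bar>0 - \<epsilon>\<bar> < e" for \<epsilon>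
  proof -
    note W = Z[OF Th[of \<epsilon>]] Z[OF \<theta>]
    have "(\<integral>x. hyp_weight \<theta> x - \<epsilon> * (hyp_weight \<theta> x * ?y x) \<partial>lborel) \<le> (\<integral>x. hyp_weight (\<theta> + \<epsilon> *\<^sub>R \<eta>) x \<partial>lborel)"
    proof (rule integral_mono)
      fix x
      \<comment> \<open>The tangent bound \<open>1 + z \<le> exp z\<close>, valid for either sign of
        \<open>\<epsilon>\<close>.\<close>
      have "hyp_weight \<theta> x * (1 + - \<epsilon> * ?y x) \<le> hyp_weight \<theta> x * exp (- \<epsilon> * ?y x)"
        by (intro mult_left_mono exp_ge_add_one_self) (simp add: hyp_weight_pos less_imp_le)
      then show "hyp_weight \<theta> x - \<epsilon> * (hyp_weight \<theta> x * ?y x) \<le> hyp_weight (\<theta> + \<epsilon> *\<^sub>R \<eta>) x"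
        unfolding hyp_weight_add_scaleR by (simp add: algebra_simps)
    qed (use W int that in \<open>auto simp: has_bochner_integral_iff\<close>)
    also have "(\<integral>x. hyp_weight \<theta> x - \<epsilon> * (hyp_weight \<theta> x * ?y x) \<partial>lborel) = ?Z 0 - \<epsilon> * ?I"
      using W(2) int by (simp add: has_bochner_integral_iff)
    also have "(\<integral>x. hyp_weight (\<theta> + \<epsilon> *\<^sub>R \<eta>) x \<partial>lborel) = ?Z \<epsilon>"
      using W(1) that by (simp add: has_bochner_integral_iff)
    finally show ?thesis by simp
  qed
  \<comment> \<open>By convexity of \<open>exp\<close>, \<open>?Z \<epsilon> + \<epsilon> * ?I\<close> has a minimum at \<open>0\<close>: this replaces differentiation
    under the integral sign.\<close>
  ultimately have "?D + ?I = 0"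
    using DERIV_local_min[OF _ e] by blast
  then show ?thesis
    using int by (simp add: has_bochner_integral_iff)
qed

section \<open>The divergences\<close>

context
  fixes \<theta> \<theta>' :: "real \<times> (real ^ 'n)" and \<nu> Z Z' :: real
  defines "\<nu> \<equiv> (real CARD('n) - 1) / 2"
    and "Z \<equiv> hyp_mass \<nu> (minkowski_norm \<theta>)"
    and "Z' \<equiv> hyp_mass \<nu> (minkowski_norm \<theta>')"
  assumes \<theta>: "\<theta> \<in> Theta_L" and \<theta>': "\<theta>' \<in> Theta_L"
begin

private lemma Z_pos: "Z > 0" "Z' > 0"
  by (simp_all add: Z_def Z'_def hyp_mass_pos minkowski_norm_pos \<theta> \<theta>')

private lemma density: "hyp_density \<theta> x = hyp_weight \<theta> x / Z" "hyp_density \<theta>' x = hyp_weight \<theta>' x / Z'"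
  by (simp_all add: hyp_density_eq \<theta> \<theta>' Z_def Z'_def \<nu>_def)

private lemma weight_integral:
  "has_bochner_integral lborel (hyp_weight \<theta>) Z" "has_bochner_integral lborel (hyp_weight \<theta>') Z'"
  using has_bochner_integral_hyp_weight[OF \<theta>] has_bochner_integral_hyp_weight[OF \<theta>']
  by (simp_all add: Z_def Z'_def \<nu>_def)

text \<open>The factors \<open>1 / fst (hyp_lift x)\<close> cancel in the density ratio, so its
  logarithm is a constant minus a linear function of \<open>hyp_lift x\<close>. Only the mass and
  one first moment of the weight remain.\<close>

lemma KL_div_hyp_density:
  "KL_div (hyp_density \<theta>) (hyp_density \<theta>') = ereal (ln (Z' / Z) +
    (deriv (bessel_K \<nu>) (minkowski_norm \<theta>) / bessel_K \<nu> (minkowski_norm \<theta>) - \<nu> / minkowski_norm \<theta>) *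
    (minkowski \<theta> (\<theta> - \<theta>') / minkowski_norm \<theta>))" (is "_ = ereal (_ + ?E)")
proof -
  let ?y = "\<lambda>x. minkowski (\<theta> - \<theta>') (hyp_lift x)"
  have "hyp_density \<theta> x * ln (hyp_density \<theta> x / hyp_density \<theta>' x)
      = ln (Z' / Z) / Z * hyp_weight \<theta> x - 1 / Z * (hyp_weight \<theta> x * ?y x)" for x
  proof -
    have "hyp_density \<theta> x / hyp_density \<theta>' x = exp (- ?y x) * (Z' / Z)"
      using Z_pos hyp_lift_pos[of x]
      by (simp add: density hyp_weight_def minkowski_diff_left exp_diff exp_minus field_simps)
    then have "ln (hyp_density \<theta> x / hyp_density \<theta>' x) = - ?y x + ln (Z' / Z)"
      using Z_pos by (simp add: ln_mult_pos ln_div)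
    then show ?thesis by (simp add: density) (simp add: algebra_simps add_divide_distrib diff_divide_distrib)
  qed
  moreover have "has_bochner_integral lborel
      (\<lambda>x. ln (Z' / Z) / Z * hyp_weight \<theta> x - 1 / Z * (hyp_weight \<theta> x * ?y x))
      (ln (Z' / Z) / Z * Z - 1 / Z * (- (Z * (deriv (bessel_K \<nu>) (minkowski_norm \<theta>) / bessel_K \<nu> (minkowski_norm \<theta>)
        - \<nu> / minkowski_norm \<theta>) * (minkowski \<theta> (\<theta> - \<theta>') / minkowski_norm \<theta>))))"
    using has_bochner_integral_hyp_weight_minkowski[OF \<theta>, of "\<theta> - \<theta>'"]
    unfolding \<nu>_def[symmetric] Z_def[symmetric]
    by (intro has_bochner_integral_diff has_bochner_integral_mult_right weight_integral) auto
  ultimately show ?thesis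
    using Z_pos unfolding KL_div_def by (subst ext_integral_has_bochner_integral) auto
qed

text \<open>Expanding the square gives \<open>p / 2 + q / 2 - sqrt (p * q)\<close>. The first two
  terms integrate to 1 together, and the last is a multiple of the weight at the midpoint.\<close>

lemma hellinger_hyp_density:
  "f_divergence (\<lambda>u. (sqrt u - 1)\<^sup>2 / 2) (hyp_density \<theta>) (hyp_density \<theta>')
    = ereal (1 - hyp_mass \<nu> (minkowski_norm (\<theta> + \<theta>') / 2) / sqrt (Z * Z'))"
proof -
  let ?m = "(1 / 2) *\<^sub>R (\<theta> + \<theta>')"
  have eq: "hyp_density \<theta> x * ((sqrt (hyp_density \<theta>' x / hyp_density \<theta> x) - 1)\<^sup>2 / 2)
      = (1 / (2 * Z')) * hyp_weight \<theta>' x + (1 / (2 * Z)) * hyp_weight \<theta> x - 1 / sqrt (Z * Z') * hyp_weight ?m x" for x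
  proof -
    have "p * ((sqrt (q / p) - 1)\<^sup>2 / 2) = q / 2 + p / 2 - sqrt (p * q)" if "p > 0" "q > 0" for p q :: real
    proof -
      have "p * sqrt (q / p) = sqrt (p * q)"
        using that by (intro real_sqrt_unique[symmetric]) (simp_all add: power_mult_distrib power2_eq_square[of p])
      then show ?thesis
        using that by (simp add: power2_diff) (simp add: field_simps)
    qed
    from this[of "hyp_density \<theta> x" "hyp_density \<theta>' x"]
    have "hyp_density \<theta> x * ((sqrt (hyp_density \<theta>' x / hyp_density \<theta> x) - 1)\<^sup>2 / 2)
        = hyp_density \<theta>' x / 2 + hyp_density \<theta> x / 2 - sqrt (hyp_density \<theta> x * hyp_density \<theta>' x)"
      using Z_pos by (simp add: density hyp_weight_pos)
    also have "sqrt (hyp_density \<theta> x * hyp_density \<theta>' x) = 1 / sqrt (Z * Z') * hyp_weight ?m x"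
      by (simp add: density real_sqrt_divide flip: sqrt_hyp_weight_mult)
    finally show ?thesis by (simp add: density)
  qed
  have "has_bochner_integral lborel (\<lambda>x. (1 / (2 * Z')) * hyp_weight \<theta>' x + (1 / (2 * Z)) * hyp_weight \<theta> x
        - 1 / sqrt (Z * Z') * hyp_weight ?m x)
      ((1 / (2 * Z')) * Z' + (1 / (2 * Z)) * Z - 1 / sqrt (Z * Z') * hyp_mass \<nu> (minkowski_norm (\<theta> + \<theta>') / 2))"
    using has_bochner_integral_hyp_weight[OF Theta_L_scaleR[OF Theta_L_add[OF \<theta> \<theta>']], of "1 / 2"]
    unfolding \<nu>_def[symmetric] minkowski_norm_scaleR
    by (intro has_bochner_integral_diff has_bochner_integral_add has_bochner_integral_mult_right weight_integral) auto
  then show ?thesis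
    using Z_pos unfolding f_divergence_def eq by (subst ext_integral_has_bochner_integral) auto
qed

text \<open>Expanding the square gives \<open>q\<^sup>2 / p + p - 2 * q\<close>. The last two terms
  integrate to \<open>1 - 2\<close>, and the first is a multiple of the weight at
  \<open>2 *\<^sub>R \<theta>' - \<theta>\<close>.\<close>

lemma chi_square_hyp_density:
  "f_divergence (\<lambda>u. (u - 1)\<^sup>2) (hyp_density \<theta>) (hyp_density \<theta>')
    = (if 2 *\<^sub>R \<theta>' - \<theta> \<in> Theta_L
       then ereal (Z * hyp_mass \<nu> (minkowski_norm (2 *\<^sub>R \<theta>' - \<theta>)) / Z'\<^sup>2 - 1) else \<infinity>)"
proof -
  let ?m = "2 *\<^sub>R \<theta>' - \<theta>"
  let ?g = "\<lambda>x. hyp_density \<theta> x * (hyp_density \<theta>' x / hyp_density \<theta> x - 1)\<^sup>2"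
  have g: "?g x = Z / Z'\<^sup>2 * hyp_weight ?m x + 1 / Z * hyp_weight \<theta> x - 2 / Z' * hyp_weight \<theta>' x" for x
  proof -
    have "p * (q / p - 1)\<^sup>2 = q\<^sup>2 / p + p - 2 * q" if "p > 0" for p q :: real
      using that by (simp add: power2_eq_square field_simps)
    from this[of "hyp_density \<theta> x" "hyp_density \<theta>' x"]
    have "?g x = (hyp_density \<theta>' x)\<^sup>2 / hyp_density \<theta> x + hyp_density \<theta> x - 2 * hyp_density \<theta>' x"
      using Z_pos by (simp add: density hyp_weight_pos)
    also have "(hyp_density \<theta>' x)\<^sup>2 / hyp_density \<theta> x = Z / Z'\<^sup>2 * hyp_weight ?m x"
      by (simp add: density power_divide mult_ac flip: hyp_weight_power2_divide)
    finally show ?thesis by (simp add: density)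
  qed
  show ?thesis
  proof (cases "?m \<in> Theta_L")
    case True
    have "has_bochner_integral lborel (\<lambda>x. Z / Z'\<^sup>2 * hyp_weight ?m x + 1 / Z * hyp_weight \<theta> x - 2 / Z' * hyp_weight \<theta>' x)
        (Z / Z'\<^sup>2 * hyp_mass \<nu> (minkowski_norm ?m) + 1 / Z * Z - 2 / Z' * Z')"
      using has_bochner_integral_hyp_weight[OF True] unfolding \<nu>_def[symmetric]
      by (intro has_bochner_integral_diff has_bochner_integral_add has_bochner_integral_mult_right weight_integral) auto
    then show ?thesis
      using Z_pos True unfolding f_divergence_def g by (subst ext_integral_has_bochner_integral) auto
  next
    case False
    have [measurable]: "?g \<in> borel_measurable borel" unfolding g by measurable
    have g_nonneg: "?g x \<ge> 0" for x
      using Z_pos by (simp add: density hyp_weight_pos less_imp_le)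
    \<comment> \<open>Infinite integrals cannot be subtracted, so the negative term is moved to the
      other side: its integral is 2, and the infinite mass must come from \<open>?g\<close>.\<close>
    have "\<infinity> = ennreal (Z / Z'\<^sup>2) * (\<integral>\<^sup>+x. ennreal (hyp_weight ?m x) \<partial>lborel)"
      using Z_pos by (simp add: nn_integral_hyp_weight_infinite[OF False] ennreal_mult_top)
    also have "\<dots> = (\<integral>\<^sup>+x. ennreal (Z / Z'\<^sup>2) * ennreal (hyp_weight ?m x) \<partial>lborel)"
      by (rule nn_integral_cmult[symmetric]) measurable
    also have "\<dots> \<le> (\<integral>\<^sup>+x. ennreal (?g x) + ennreal (2 / Z' * hyp_weight \<theta>' x) \<partial>lborel)"
    proof (rule nn_integral_mono)
      fix x
      have "Z / Z'\<^sup>2 * hyp_weight ?m x \<le> ?g x + 2 / Z' * hyp_weight \<theta>' x"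
        unfolding g using Z_pos by (simp add: hyp_weight_pos less_imp_le)
      then have "ennreal (Z / Z'\<^sup>2 * hyp_weight ?m x) \<le> ennreal (?g x + 2 / Z' * hyp_weight \<theta>' x)"
        by (rule ennreal_leI)
      then show "ennreal (Z / Z'\<^sup>2) * ennreal (hyp_weight ?m x) \<le> ennreal (?g x) + ennreal (2 / Z' * hyp_weight \<theta>' x)"
        using Z_pos g_nonneg[of x] hyp_weight_pos[of ?m x] hyp_weight_pos[of \<theta>' x]
        by (subst ennreal_mult[symmetric], simp, simp, subst ennreal_plus[symmetric]) simp_all
    qed
    also have "\<dots> = (\<integral>\<^sup>+x. ennreal (?g x) \<partial>lborel) + (\<integral>\<^sup>+x. ennreal (2 / Z' * hyp_weight \<theta>' x) \<partial>lborel)"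
      by (rule nn_integral_add) measurable
    also have "(\<integral>\<^sup>+x. ennreal (2 / Z' * hyp_weight \<theta>' x) \<partial>lborel) = ennreal 2"
      using has_bochner_integral_mult_right[OF weight_integral(2), of "2 / Z'"] Z_pos
      by (subst nn_integral_eq_integral) (auto simp: has_bochner_integral_iff hyp_weight_pos less_imp_le)
    finally have "(\<integral>\<^sup>+x. ennreal (?g x) \<partial>lborel) = \<infinity>"
      by (auto simp: top_unique)
    moreover have "(\<integral>\<^sup>+x. ennreal (- ?g x) \<partial>lborel) = 0"
      using g_nonneg by (simp add: ennreal_neg)
    ultimately show ?thesis
      using False by (simp add: f_divergence_def ext_integral_def)
  qed
qed

end

section \<open>The divergences in closed form\<close>

theorem proposition8:
  fixes \<theta> \<theta>' :: "real \<times> (real ^ 'n)"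
  defines "d \<equiv> real CARD('n)"
  defines "K \<equiv> bessel_K ((d - 1) / 2)"
  assumes "CARD('n) \<ge> 2" and "\<theta> \<in> Theta_L" and "\<theta>' \<in> Theta_L"
  shows "KL_div (hyp_density \<theta>) (hyp_density \<theta>') =
      ereal (ln (K (minkowski_norm \<theta>') / K (minkowski_norm \<theta>))
        + (d - 1) / 2 * (ln (minkowski_norm \<theta> / minkowski_norm \<theta>')
            + minkowski \<theta> \<theta>' / minkowski \<theta> \<theta> - 1)
        + minkowski \<theta> (\<theta> - \<theta>') * deriv K (minkowski_norm \<theta>)
            / (minkowski_norm \<theta> * K (minkowski_norm \<theta>)))
    \<and> f_divergence (\<lambda>u. (sqrt u - 1)\<^sup>2 / 2) (hyp_density \<theta>) (hyp_density \<theta>') =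
      ereal (1 - 2 powr ((d - 1) / 2) *
        (minkowski_norm \<theta> powr ((d - 1) / 4) * minkowski_norm \<theta>' powr ((d - 1) / 4)
            * K (minkowski_norm (\<theta> + \<theta>') / 2)
          / (minkowski_norm (\<theta> + \<theta>') powr ((d - 1) / 2)
            * sqrt (K (minkowski_norm \<theta>) * K (minkowski_norm \<theta>')))))
    \<and> f_divergence (\<lambda>u. (u - 1)\<^sup>2) (hyp_density \<theta>) (hyp_density \<theta>') =
      (if 2 *\<^sub>R \<theta>' - \<theta> \<in> Theta_L
       then ereal (minkowski_norm \<theta>' powr (d - 1)
            * K (minkowski_norm (2 *\<^sub>R \<theta>' - \<theta>)) * K (minkowski_norm \<theta>)
          / (minkowski_norm (2 *\<^sub>R \<theta>' - \<theta>) powr ((d - 1) / 2)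
            * minkowski_norm \<theta> powr ((d - 1) / 2)
            * (K (minkowski_norm \<theta>'))\<^sup>2) - 1)
       else \<infinity>)"
proof -
  note Th = \<open>\<theta> \<in> Theta_L\<close> \<open>\<theta>' \<in> Theta_L\<close>
  define \<nu> where "\<nu> = (d - 1) / 2"
  define t t' where "t = minkowski_norm \<theta>" and "t' = minkowski_norm \<theta>'"
  have t: "t > 0" "t' > 0" using Th by (simp_all add: t_def t'_def minkowski_norm_pos)
  have K: "K s > 0" if "s > 0" for s using that by (simp add: K_def bessel_K_pos)
  have mass: "hyp_mass \<nu> s = 2 * (2 * pi) powr \<nu> * K s / s powr \<nu>" if "s > 0" for s
    using that by (simp add: hyp_mass_def K_def \<nu>_def powr_divide)
  have \<nu>': "(d - 1) / 4 = \<nu> / 2" "d - 1 = \<nu> + \<nu>"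
    by (simp_all add: \<nu>_def)
  have tt: "minkowski \<theta> \<theta> = t * t"
    using minkowski_self_pos[OF Th(1)] by (simp add: t_def minkowski_norm_def)
  note div = KL_div_hyp_density[OF Th] hellinger_hyp_density[OF Th] chi_square_hyp_density[OF Th]
  \<comment> \<open>The order inside \<open>K_def\<close> must itself be folded to
    \<open>\<nu>\<close> before \<open>K_def\<close> can match.\<close>
  note div = div[folded d_def, folded \<nu>_def, folded K_def[folded \<nu>_def] t_def t'_def]
  have ln_mass: "ln (hyp_mass \<nu> t' / hyp_mass \<nu> t) = ln (K t' / K t) + \<nu> * ln (t / t')"
    using t K[OF t(1)] K[OF t(2)] by (simp add: mass ln_mult ln_div ln_powr algebra_simps)
  have diff: "minkowski \<theta> (\<theta> - \<theta>') = t * t - minkowski \<theta> \<theta>'"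
    unfolding tt[symmetric] by (simp add: minkowski_def algebra_simps)
  \<comment> \<open>By \<open>diff\<close>, the term \<open>- \<nu> / t\<close> contributes
    \<open>- \<nu> * (1 - minkowski \<theta> \<theta>' / (t * t))\<close>.\<close>
  have 1: "ln (hyp_mass \<nu> t' / hyp_mass \<nu> t) + (deriv K t / K t - \<nu> / t) * (minkowski \<theta> (\<theta> - \<theta>') / t)
      = ln (K t' / K t) + \<nu> * (ln (t / t') + minkowski \<theta> \<theta>' / (t * t) - 1)
        + minkowski \<theta> (\<theta> - \<theta>') * deriv K t / (t * K t)"
    unfolding ln_mass diff using t K[OF t(1)] by (simp add: field_simps)
  \<comment> \<open>The factor \<open>2 powr \<nu>\<close> comes from evaluating the mass at
    \<open>s / 2\<close>; the common constant \<open>2 * (2 * pi) powr \<nu>\<close>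
    cancels.\<close>
  have 2: "hyp_mass \<nu> (s / 2) / sqrt (hyp_mass \<nu> t * hyp_mass \<nu> t')
      = 2 powr \<nu> * (t powr (\<nu> / 2) * t' powr (\<nu> / 2) * K (s / 2) / (s powr \<nu> * sqrt (K t * K t')))" if s: "s > 0" for s
  proof -
    have sq: "sqrt (x powr \<nu>) = x powr (\<nu> / 2)" if "x > 0" for x :: real
      using that by (simp add: powr_powr flip: powr_half_sqrt)
    have "sqrt (hyp_mass \<nu> t * hyp_mass \<nu> t') = sqrt ((2 * (2 * pi) powr \<nu>)\<^sup>2 * (K t * K t') / (t powr \<nu> * t' powr \<nu>))"
      using t by (simp add: mass power2_eq_square mult_ac)
    also have "\<dots> = 2 * (2 * pi) powr \<nu> * sqrt (K t * K t') / (t powr (\<nu> / 2) * t' powr (\<nu> / 2))"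
      using t by (simp only: real_sqrt_divide real_sqrt_mult[of "X\<^sup>2" for X] real_sqrt_abs real_sqrt_mult[of "t powr \<nu>"] sq) simp
    finally show ?thesis
      using t s K[OF t(1)] K[OF t(2)] by (simp add: mass powr_divide field_simps)
  qed
  have 3: "hyp_mass \<nu> t * hyp_mass \<nu> s / (hyp_mass \<nu> t')\<^sup>2
      = t' powr (\<nu> + \<nu>) * K s * K t / (s powr \<nu> * t powr \<nu> * (K t')\<^sup>2)" if s: "s > 0" for s
    unfolding powr_add using t s K[OF t(2)] by (simp add: mass power2_eq_square field_simps)
  \<comment> \<open>The third identity is instantiated without discharging membership of
    \<open>2 *\<^sub>R \<theta>' - \<theta>\<close> in the cone; the conditional in the goal
    supplies it.\<close>
  show ?thesis
    using 2[OF minkowski_norm_pos[OF Theta_L_add[OF Th]]] 3[OF minkowski_norm_pos[of "2 *\<^sub>R \<theta>' - \<theta>"]]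
    unfolding div 1 tt \<nu>' \<nu>_def[symmetric] t_def[symmetric] t'_def[symmetric] by simp
qed

end
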